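(* Assume that the matrix $[B_i]_{B_{i-1}}$ has been computed for some $i$ such that $1\le i\le n-1$. Then the matrix $[J_{i+1}]_{B_i}$ can be computed in $O\!\left(\binom nk\right)$ operations.
   Context: Let $0\le k\le n$ and let $X$ be the set of words $w_1\dots w_n$ in the alphabet $\{1,2\}$ with exactly $k$ letters $1$ (the word corresponds to the $k$-subset $\{j: w_j=1\}$ of $\{1,\dots,n\}$). The symmetric group $S_n$ acts on $X$ via its action on $k$-subsets. $\mathcal F$ is the space of complex functions on $X$, with $\sigma f=f\circ\sigma^{-1}$ and the inner product for which the delta functions $\delta(x)$, $x\in X$, are orthonormal. For $i\le n$, $S_i\subset S_n$ is the subgroup fixing $i+1,\dots,n$; irreducible representations of $S_i$ are indexed by Young diagrams with $i$ boxes in the usual way, and $\mathcal F_{i,\lambda}$ is the $\lambda$-isotypic component of $\mathcal F$ as an $S_i$-module. Write $\lambda\nearrow\mu$ if $\mu$ is obtained from $\lambda$ by adding one box. For Young diagrams $\lambda_1,\dots,\lambda_p$ with $\lambda_j$ having $j$ boxes, $\mathcal F_{\lambda_1\dots\lambda_p}=\mathcal F_{1,\lambda_1}\cap\dots\cap\mathcal F_{p,\lambda_p}$. For a word $c_q\dots c_n$ in $\{1,2\}$, $\mathcal F^{c_q\dots c_n}$ is the span of the $\delta(w)$ with $w\in X$, $w_q\dots w_n=c_q\dots c_n$; for $q=n+1$ (empty word) it is $\mathcal F$. Put $\mathcal F_{\lambda_1\dots\lambda_p}^{c_q\dots c_n}=\mathcal F_{\lambda_1\dots\lambda_p}\cap\mathcal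 F^{c_q\dots c_n}$ (for $p=0$ this means $\mathcal F^{c_q\dots c_n}$). For $0\le i\le n$, $\mathcal F$ is the orthogonal direct sum of the one-dimensional subspaces $\mathcal F_{\lambda_1\dots\lambda_i}^{c_{i+1}\dots c_n}$, over all words $c_{i+1}\dots c_n$ with exactly $k-r$ letters $1$ for some $0\le r\le k$, and all chains $\lambda_1\nearrow\dots\nearrow\lambda_i$ with $\lambda_i=(i-a,a)$, $0\le a\le\min(r,i-r)$. The $i$-th intermediate basis $B_i$ is the orthonormal basis, unique up to scalars, of $\mathcal F$ adapted to this decomposition, i.e. consisting of one unit vector from each of these subspaces; $B_0$ is the basis of delta functions. $[B]_{B'}$ denotes the change of basis matrix, whose columns are the elements of $B$ written in the basis $B'$; for a linear operator $T$ on $\mathcal F$, $[T]_B$ is the matrix whose columns are the images under $T$ of the elements of $B$, written in the basis $B$. The Jucys-Murphy element is $J_j=(1\,j)+(2\,j)+\dots+((j-1)\,j)\in\mathbb C[S_n]$ (with $J_1=0$), regarded as a linear operator on $\mathcal F$. Computational model: a single complex multiplication and addition counts as one operation. Only these algebraic operations are counted; operations involved in the storage of the matrices (for example reordering rows and columns of a matrix) are not counted.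
   Formalization: Since the bases are unique only up to scalars, the input matrix alone need not determine the result; the computation may also use the entries of the matrix of (i i+1) in B_{i-1} (0/1 when (i i+1) permutes B_{i-1}) and complex conjugation, counted as one operation. *)

theory Defs
  imports Complex_Main "HOL-Combinatorics.Permutations" "HOL-Library.Function_Algebras"
begin

section \<open>Complex functions and the action of the symmetric group\<close>

abbreviation cscale :: "complex \<Rightarrow> ('b \<Rightarrow> complex) \<Rightarrow> 'b \<Rightarrow> complex" where
  "cscale a f \<equiv> (\<lambda>x. a * f x)"

global_interpretation cfun: vector_space "cscale :: complex \<Rightarrow> ('b \<Rightarrow> complex) \<Rightarrow> 'b \<Rightarrow> complex"
  by unfold_locales (auto simp: fun_eq_iff algebra_simps)

definition words :: "nat \<Rightarrow> nat \<Rightarrow> nat list set" where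
  "words n k = {w. length w = n \<and> set w \<subseteq> {1, 2} \<and> count_list w 1 = k}"

text \<open>Functions on \<open>words n k\<close> are total functions vanishing elsewhere.\<close>

definition Fun :: "nat \<Rightarrow> nat \<Rightarrow> (nat list \<Rightarrow> complex) set" where
  "Fun n k = {f. \<forall>w. w \<notin> words n k \<longrightarrow> f w = 0}"

definition delta :: "nat list \<Rightarrow> nat list \<Rightarrow> complex" where
  "delta w = (\<lambda>v. if v = w then 1 else 0)"

definition inner_F :: "nat \<Rightarrow> nat \<Rightarrow> (nat list \<Rightarrow> complex) \<Rightarrow> (nat list \<Rightarrow> complex) \<Rightarrow> complex" where
  "inner_F n k f g = (\<Sum>w\<in>words n k. f w * cnj (g w))"

definition Sym :: "nat \<Rightarrow> (nat \<Rightarrow> nat) set" where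
  "Sym i = {\<sigma>. \<sigma> permutes {1..i}}"

text \<open>Positions are numbered from 1. The positions of the letter 1 in \<open>act_word \<sigma> w\<close> are the
  images under \<open>\<sigma>\<close> of those in \<open>w\<close>.\<close>

definition act_word :: "(nat \<Rightarrow> nat) \<Rightarrow> nat list \<Rightarrow> nat list" where
  "act_word \<sigma> w = map (\<lambda>j. w ! (inv \<sigma> j - 1)) [1..<length w + 1]"

definition act :: "(nat \<Rightarrow> nat) \<Rightarrow> (nat list \<Rightarrow> complex) \<Rightarrow> nat list \<Rightarrow> complex" where
  "act \<sigma> f = (\<lambda>w. f (act_word (inv \<sigma>) w))"

definition jucys_murphy :: "nat \<Rightarrow> (nat list \<Rightarrow> complex) \<Rightarrow> nat list \<Rightarrow> complex" where
  "jucys_murphy j f = (\<Sum>m\<in>{1..<j}. act (transpose m j) f)"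


section \<open>Young diagrams and Specht modules\<close>

text \<open>A diagram is its set of boxes (row, column), both numbered from 0.\<close>

type_synonym diagram = "(nat \<times> nat) set"

definition young_diagram :: "diagram \<Rightarrow> bool" where
  "young_diagram \<nu> \<longleftrightarrow> finite \<nu> \<and>
     (\<forall>r c r' c'. (r, c) \<in> \<nu> \<longrightarrow> r' \<le> r \<longrightarrow> c' \<le> c \<longrightarrow> (r', c') \<in> \<nu>)"

definition adds_box :: "diagram \<Rightarrow> diagram \<Rightarrow> bool" where
  "adds_box \<nu> \<mu> \<longleftrightarrow> (\<exists>b. b \<notin> \<nu> \<and> \<mu> = insert b \<nu>)"

definition two_row :: "nat \<Rightarrow> nat \<Rightarrow> diagram" where
  "two_row p q = {0} \<times> {..<p} \<union> {1} \<times> {..<q}"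

text \<open>The filling of a diagram by \<open>1, 2, \<dots>\<close> along the rows, top to bottom.\<close>

definition row_filling :: "diagram \<Rightarrow> nat \<times> nat \<Rightarrow> nat" where
  "row_filling \<nu> b = card {b' \<in> \<nu>. fst b' < fst b \<or> fst b' = fst b \<and> snd b' \<le> snd b}"

definition row_group :: "diagram \<Rightarrow> (nat \<Rightarrow> nat) set" where
  "row_group \<nu> = {\<sigma> \<in> Sym (card \<nu>).
     \<forall>b\<in>\<nu>. \<exists>b'\<in>\<nu>. fst b' = fst b \<and> \<sigma> (row_filling \<nu> b) = row_filling \<nu> b'}"

definition column_group :: "diagram \<Rightarrow> (nat \<Rightarrow> nat) set" where
  "column_group \<nu> = {\<sigma> \<in> Sym (card \<nu>).
     \<forall>b\<in>\<nu>. \<exists>b'\<in>\<nu>. snd b' = snd b \<and> \<sigma> (row_filling \<nu> b) = row_filling \<nu> b'}"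

text \<open>Elements of the group algebra of \<open>Sym m\<close> are functions on permutations; the Young symmetrizer
  is the product of the row symmetrizer and the column antisymmetrizer, in this order.\<close>

definition young_symmetrizer :: "diagram \<Rightarrow> (nat \<Rightarrow> nat) \<Rightarrow> complex" where
  "young_symmetrizer \<nu> =
     (\<lambda>\<tau>. \<Sum>p\<in>row_group \<nu>. \<Sum>q\<in>column_group \<nu>. if \<tau> = p \<circ> q then of_int (sign q) else 0)"

definition left_mult :: "(nat \<Rightarrow> nat) \<Rightarrow> ((nat \<Rightarrow> nat) \<Rightarrow> complex) \<Rightarrow> (nat \<Rightarrow> nat) \<Rightarrow> complex" where
  "left_mult \<sigma> u = (\<lambda>\<tau>. u (inv \<sigma> \<circ> \<tau>))"

text \<open>The irreducible representation indexed by \<open>\<nu>\<close>: the left ideal generated by the Young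
  symmetrizer.\<close>

definition specht :: "diagram \<Rightarrow> ((nat \<Rightarrow> nat) \<Rightarrow> complex) set" where
  "specht \<nu> = cfun.span ((\<lambda>\<sigma>. left_mult \<sigma> (young_symmetrizer \<nu>)) ` Sym (card \<nu>))"

definition iso_to_specht :: "diagram \<Rightarrow> (nat list \<Rightarrow> complex) set \<Rightarrow> bool" where
  "iso_to_specht \<nu> W \<longleftrightarrow> (\<exists>\<phi>. bij_betw \<phi> (specht \<nu>) W \<and>
     (\<forall>u\<in>specht \<nu>. \<forall>v\<in>specht \<nu>. \<phi> (u + v) = \<phi> u + \<phi> v) \<and>
     (\<forall>a. \<forall>u\<in>specht \<nu>. \<phi> (cscale a u) = cscale a (\<phi> u)) \<and>
     (\<forall>\<sigma>\<in>Sym (card \<nu>). \<forall>u\<in>specht \<nu>. \<phi> (left_mult \<sigma> u) = act \<sigma> (\<phi> u)))"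

text \<open>The sum of all submodules, for \<open>Sym (card \<nu>)\<close>, that are isomorphic to \<open>specht \<nu>\<close>.\<close>

definition isotypic :: "nat \<Rightarrow> nat \<Rightarrow> diagram \<Rightarrow> (nat list \<Rightarrow> complex) set" where
  "isotypic n k \<nu> = cfun.span (\<Union>{W. W \<subseteq> Fun n k \<and> cfun.subspace W \<and>
     (\<forall>\<sigma>\<in>Sym (card \<nu>). act \<sigma> ` W \<subseteq> W) \<and> iso_to_specht \<nu> W})"


section \<open>The intermediate bases\<close>

definition chain_space :: "nat \<Rightarrow> nat \<Rightarrow> diagram list \<Rightarrow> (nat list \<Rightarrow> complex) set" where
  "chain_space n k ls = {f \<in> Fun n k. \<forall>\<nu>\<in>set ls. f \<in> isotypic n k \<nu>}"

definition suffix_space :: "nat \<Rightarrow> nat \<Rightarrow> nat list \<Rightarrow> (nat list \<Rightarrow> complex) set" where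
  "suffix_space n k c = cfun.span {delta w | w. w \<in> words n k \<and> drop (n - length c) w = c}"

text \<open>A chain of diagrams with \<open>1, \<dots>, i\<close> boxes and a word \<open>c\<^sub>i\<^sub>+\<^sub>1 \<dots> c\<^sub>n\<close>.\<close>

type_synonym label = "diagram list \<times> nat list"

text \<open>The condition \<open>a \<le> min(r, i - r)\<close> is read over the integers.\<close>

definition labels :: "nat \<Rightarrow> nat \<Rightarrow> nat \<Rightarrow> label set" where
  "labels n k i = {(ls, c). length ls = i \<and>
     (\<forall>j<i. young_diagram (ls ! j) \<and> card (ls ! j) = Suc j) \<and>
     (\<forall>j. Suc j < i \<longrightarrow> adds_box (ls ! j) (ls ! Suc j)) \<and>
     length c = n - i \<and> set c \<subseteq> {1, 2} \<and>
     (\<exists>r a. r \<le> k \<and> count_list c 1 = k - r \<and> a \<le> r \<and> a + r \<le> i \<and>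
        (0 < i \<longrightarrow> ls ! (i - 1) = two_row (i - a) a))}"

definition intermediate_basis ::
    "nat \<Rightarrow> nat \<Rightarrow> nat \<Rightarrow> (label \<Rightarrow> nat list \<Rightarrow> complex) \<Rightarrow> bool" where
  "intermediate_basis n k i b \<longleftrightarrow>
     (\<forall>(ls, c)\<in>labels n k i. b (ls, c) \<in> chain_space n k ls \<inter> suffix_space n k c) \<and>
     (\<forall>x\<in>labels n k i. \<forall>y\<in>labels n k i. inner_F n k (b x) (b y) = (if x = y then 1 else 0)) \<and>
     cfun.span (b ` labels n k i) = Fun n k \<and>
     (i = 0 \<longrightarrow> (\<forall>(ls, c)\<in>labels n k 0. b (ls, c) = delta c))"

text \<open>Matrices are indexed (row, column) by labels and vanish outside the index sets.\<close>

type_synonym lmatrix = "label \<times> label \<Rightarrow> complex"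

definition columns_in ::
    "label set \<Rightarrow> (label \<Rightarrow> nat list \<Rightarrow> complex) \<Rightarrow> label set \<Rightarrow> (label \<Rightarrow> nat list \<Rightarrow> complex) \<Rightarrow> lmatrix" where
  "columns_in I b J v = (\<lambda>(x, y).
     if x \<in> I \<and> y \<in> J then cfun.representation (b ` I) (v y) (b x) else 0)"

definition change_matrix :: "nat \<Rightarrow> nat \<Rightarrow> nat \<Rightarrow> (label \<Rightarrow> nat list \<Rightarrow> complex) \<Rightarrow>
    nat \<Rightarrow> (label \<Rightarrow> nat list \<Rightarrow> complex) \<Rightarrow> lmatrix" where
  "change_matrix n k i b i' b' = columns_in (labels n k i') b' (labels n k i) b"

definition operator_matrix :: "nat \<Rightarrow> nat \<Rightarrow> nat \<Rightarrow> (label \<Rightarrow> nat list \<Rightarrow> complex) \<Rightarrow>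
    ((nat list \<Rightarrow> complex) \<Rightarrow> nat list \<Rightarrow> complex) \<Rightarrow> lmatrix" where
  "operator_matrix n k i b T = columns_in (labels n k i) b (labels n k i) (\<lambda>y. T (b y))"


section \<open>Straight-line programs\<close>

text \<open>Each instruction appends one number to the list of numbers computed so far, whose positions
  are the addresses used by the arithmetic instructions. Conjugation is needed to
  invert a unitary matrix whose entries are not real, and it is counted.\<close>

datatype 'p instr = Const complex | Input 'p | Add nat nat | Mult nat nat | Conj nat

definition fetch :: "complex list \<Rightarrow> nat \<Rightarrow> complex" where
  "fetch vs a = (if a < length vs then vs ! a else 0)"

fun instr_value :: "('p \<Rightarrow> complex) \<Rightarrow> complex list \<Rightarrow> 'p instr \<Rightarrow> complex" where
  "instr_value inp vs (Const z) = z"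
| "instr_value inp vs (Input p) = inp p"
| "instr_value inp vs (Add a b) = fetch vs a + fetch vs b"
| "instr_value inp vs (Mult a b) = fetch vs a * fetch vs b"
| "instr_value inp vs (Conj a) = cnj (fetch vs a)"

definition run :: "('p \<Rightarrow> complex) \<Rightarrow> 'p instr list \<Rightarrow> complex list" where
  "run inp P = foldl (\<lambda>vs ins. vs @ [instr_value inp vs ins]) [] P"

fun is_arith :: "'p instr \<Rightarrow> bool" where
  "is_arith (Const z) = False"
| "is_arith (Input p) = False"
| "is_arith (Add a b) = True"
| "is_arith (Mult a b) = True"
| "is_arith (Conj a) = True"

definition op_count :: "'p instr list \<Rightarrow> nat" where
  "op_count P = length (filter is_arith P)"

text \<open>Programs will be allowed integer constants and, in addition, the entries of the matrix \<open>S\<close> of the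
  transposition \<open>(i i+1)\<close> in the basis \<open>B' = B\<^sub>i\<^sub>-\<^sub>1\<close>. That matrix has one nonzero entry in each row and
  column, and it is a permutation matrix for a suitable choice of the scalars in \<open>B'\<close>; the program
  then uses integer constants only. For arbitrary scalars the entries of \<open>S\<close> are needed:
  multiplying by a common scalar all elements of \<open>B'\<close> and \<open>B = B\<^sub>i\<close> that lie in
  \<open>suffix_space n k c\<close>, for one word \<open>c\<close> of length \<open>n - i\<close>, leaves \<open>change_matrix n k i B (i - 1) B'\<close>
  unchanged but can change the matrix of the Jucys-Murphy operator in \<open>B\<close>.\<close>

definition constants :: "'p instr list \<Rightarrow> complex set" where
  "constants P = {z. Const z \<in> set P}"

text \<open>The matrix \<open>M\<close> is assembled from the computed numbers according to \<open>out\<close>.\<close>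

definition computes_matrix ::
    "'p instr list \<Rightarrow> (label \<times> label \<Rightarrow> nat) \<Rightarrow> ('p \<Rightarrow> complex) \<Rightarrow> label set \<Rightarrow> lmatrix \<Rightarrow> bool" where
  "computes_matrix P out inp I M \<longleftrightarrow>
     (\<forall>x\<in>I. \<forall>y\<in>I. M (x, y) = fetch (run inp P) (out (x, y)))"

end

theory Submission imports Defs begin

text \<open>Let \<open>s = (i i+1)\<close>. Since \<open>J\<^sub>i\<^sub>+\<^sub>1 = s J\<^sub>i s + s\<close> and \<open>J\<^sub>i\<close> is diagonal in \<open>B\<^sub>i\<close> with the contents of the
  added boxes as entries, the matrix of \<open>J\<^sub>i\<^sub>+\<^sub>1\<close> is a polynomial expression in the matrix of \<open>s\<close> in \<open>B\<^sub>i\<close>,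
  and the latter is obtained from the matrix of \<open>s\<close> in \<open>B\<^sub>i\<^sub>-\<^sub>1\<close> by the unitary change of basis. All these matrices are
  block diagonal: a block is given by the first \<open>i - 1\<close> diagrams and the last \<open>n - i - 1\<close> letters, and has
  size at most 4 because a two-row diagram can be extended in at most two ways. So each of the at most
  \<open>4 (n choose k)\<close> relevant entries costs a bounded number of operations.

  That different chains of diagrams give orthogonal functions is seen without Schur's lemma: the class sum
  of the transpositions of \<open>S\<^sub>j\<close> is self-adjoint and acts on the Specht module of \<open>\<nu>\<close> by the sum of the
  contents of \<open>\<nu>\<close>, and these sums differ for different two-row diagrams with \<open>j\<close> boxes.\<close>

section \<open>Transpositions acting on Specht modules\<close>

lemma sum_fun_apply: "(\<Sum>x\<in>A. f x) y = (\<Sum>x\<in>A. f x y)"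
  by (induction A rule: infinite_finite_induct) auto

lemma transpose_conj_inv:
  assumes "bij p"
  shows "inv p \<circ> transpose a b \<circ> p = transpose (inv p a) (inv p b)"
  using bij_is_inj[OF assms] bij_is_surj[OF assms]
  by (auto simp: fun_eq_iff transpose_def surj_f_inv_f)

text \<open>Centrality of the class sum of transpositions: conjugation by \<open>\<sigma>\<close>
  permutes the ordered pairs of points of \<open>A\<close>, so both summation indices can be
  relabelled by \<open>inv \<sigma>\<close>.\<close>

lemma sum_transpose_conj:
  assumes "\<sigma> permutes A"
  shows "(\<Sum>a\<in>A. \<Sum>b\<in>A. g (inv \<sigma> \<circ> transpose a b \<circ> \<sigma>)) = (\<Sum>a\<in>A. \<Sum>b\<in>A. g (transpose a b))"
proof -
  have inv: "bij_betw (inv \<sigma>) A A" and bij: "bij \<sigma>"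
    using assms permutes_inv permutes_imp_bij permutes_bij by blast+
  have "(\<Sum>a\<in>A. \<Sum>b\<in>A. g (inv \<sigma> \<circ> transpose a b \<circ> \<sigma>))
      = (\<Sum>a\<in>A. \<Sum>b\<in>A. g (transpose (inv \<sigma> a) (inv \<sigma> b)))"
    using transpose_conj_inv[OF bij] by simp
  also have "\<dots> = (\<Sum>a\<in>A. \<Sum>b\<in>A. g (transpose (inv \<sigma> a) b))"
    by (intro sum.cong refl sum.reindex_bij_betw[OF inv])
  also have "\<dots> = (\<Sum>a\<in>A. \<Sum>b\<in>A. g (transpose a b))"
    by (rule sum.reindex_bij_betw[OF inv])
  finally show ?thesis .
qed

section \<open>Row filling, row group and column group\<close>

lemma row_filling_bij:
  assumes "finite \<nu>"
  shows "bij_betw (row_filling \<nu>) \<nu> {1..card \<nu>}"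
proof -
  let ?D = "\<lambda>b. {b' \<in> \<nu>. fst b' < fst b \<or> fst b' = fst b \<and> snd b' \<le> snd b}"
  have mono: "row_filling \<nu> b < row_filling \<nu> b'"
    if "b \<in> \<nu>" "b' \<in> \<nu>" "fst b < fst b' \<or> fst b = fst b' \<and> snd b < snd b'" for b b'
  proof -
    have "?D b \<subseteq> ?D b'" "b' \<in> ?D b'" "b' \<notin> ?D b"
      using that by auto
    then have "?D b \<subset> ?D b'" by blast
    then show ?thesis
      unfolding row_filling_def using assms by (intro psubset_card_mono) auto
  qed
  have inj: "inj_on (row_filling \<nu>) \<nu>"
  proof (rule inj_onI)
    fix b b' assume "b \<in> \<nu>" "b' \<in> \<nu>" and eq: "row_filling \<nu> b = row_filling \<nu> b'"
    then have "\<not> (fst b < fst b' \<or> fst b = fst b' \<and> snd b < snd b')"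
      "\<not> (fst b' < fst b \<or> fst b' = fst b \<and> snd b' < snd b)"
      using mono[of b b'] mono[of b' b] by auto
    then show "b = b'" by (auto simp: prod_eq_iff)
  qed
  have "row_filling \<nu> b \<in> {1..card \<nu>}" if "b \<in> \<nu>" for b
  proof -
    have "card {b} \<le> row_filling \<nu> b" "row_filling \<nu> b \<le> card \<nu>"
      unfolding row_filling_def using assms that by (intro card_mono; auto)+
    then show ?thesis by simp
  qed
  then have "row_filling \<nu> ` \<nu> \<subseteq> {1..card \<nu>}" by blast
  moreover have "card (row_filling \<nu> ` \<nu>) = card {1..card \<nu>}"
    using inj by (simp add: card_image)
  ultimately have "row_filling \<nu> ` \<nu> = {1..card \<nu>}"
    by (simp add: card_subset_eq)
  with inj show ?thesis by (simp add: bij_betw_def)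
qed

lemma transpose_row_filling:
  assumes "finite \<nu>" "x \<in> \<nu>" "y \<in> \<nu>" "b \<in> \<nu>"
  shows "transpose (row_filling \<nu> x) (row_filling \<nu> y) (row_filling \<nu> b) = row_filling \<nu> (transpose x y b)"
  using row_filling_bij[OF assms(1)] assms
  by (auto simp: transpose_def bij_betw_def inj_on_def)

lemma transpose_row_filling_Sym:
  assumes "finite \<nu>" "x \<in> \<nu>" "y \<in> \<nu>"
  shows "transpose (row_filling \<nu> x) (row_filling \<nu> y) \<in> Sym (card \<nu>)"
  using row_filling_bij[OF assms(1)] assms
  by (auto simp: Sym_def bij_betw_def intro!: permutes_swap_id)

lemma transpose_mem_row_group:
  assumes "finite \<nu>" "x \<in> \<nu>" "y \<in> \<nu>" "fst x = fst y"
  shows "transpose (row_filling \<nu> x) (row_filling \<nu> y) \<in> row_group \<nu>"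
proof -
  have "transpose x y b \<in> \<nu>" "fst (transpose x y b) = fst b" if "b \<in> \<nu>" for b
    using assms that by (auto simp: transpose_def)
  then show ?thesis
    unfolding row_group_def using transpose_row_filling_Sym[OF assms(1-3)] transpose_row_filling[OF assms(1-3)]
    by blast
qed

lemma transpose_mem_column_group:
  assumes "finite \<nu>" "x \<in> \<nu>" "y \<in> \<nu>" "snd x = snd y"
  shows "transpose (row_filling \<nu> x) (row_filling \<nu> y) \<in> column_group \<nu>"
proof -
  have "transpose x y b \<in> \<nu>" "snd (transpose x y b) = snd b" if "b \<in> \<nu>" for b
    using assms that by (auto simp: transpose_def)
  then show ?thesis
    unfolding column_group_def using transpose_row_filling_Sym[OF assms(1-3)] transpose_row_filling[OF assms(1-3)]
    by blast
qed

lemma row_group_comp: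
  assumes "p \<in> row_group \<nu>" "q \<in> row_group \<nu>"
  shows "p \<circ> q \<in> row_group \<nu>"
proof -
  have "\<exists>b'\<in>\<nu>. fst b' = fst b \<and> (p \<circ> q) (row_filling \<nu> b) = row_filling \<nu> b'" if b: "b \<in> \<nu>" for b
  proof -
    obtain b1 where b1: "b1 \<in> \<nu>" "fst b1 = fst b" "q (row_filling \<nu> b) = row_filling \<nu> b1"
      using assms(2) b by (auto simp: row_group_def)
    obtain b2 where "b2 \<in> \<nu>" "fst b2 = fst b1" "p (row_filling \<nu> b1) = row_filling \<nu> b2"
      using assms(1) b1(1) by (auto simp: row_group_def)
    with b1 show ?thesis by auto
  qed
  moreover have "p \<circ> q \<in> Sym (card \<nu>)"
    using assms by (simp add: row_group_def Sym_def permutes_compose)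
  ultimately show ?thesis by (simp add: row_group_def)
qed

lemma column_group_comp:
  assumes "p \<in> column_group \<nu>" "q \<in> column_group \<nu>"
  shows "p \<circ> q \<in> column_group \<nu>"
proof -
  have "\<exists>b'\<in>\<nu>. snd b' = snd b \<and> (p \<circ> q) (row_filling \<nu> b) = row_filling \<nu> b'" if b: "b \<in> \<nu>" for b
  proof -
    obtain b1 where b1: "b1 \<in> \<nu>" "snd b1 = snd b" "q (row_filling \<nu> b) = row_filling \<nu> b1"
      using assms(2) b by (auto simp: column_group_def)
    obtain b2 where "b2 \<in> \<nu>" "snd b2 = snd b1" "p (row_filling \<nu> b1) = row_filling \<nu> b2"
      using assms(1) b1(1) by (auto simp: column_group_def)
    with b1 show ?thesis by auto
  qed
  moreover have "p \<circ> q \<in> Sym (card \<nu>)"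
    using assms by (simp add: column_group_def Sym_def permutes_compose)
  ultimately show ?thesis by (simp add: column_group_def)
qed

section \<open>Products of row symmetrizer, permutation and column antisymmetrizer\<close>

lemma Sym_permutation: "\<sigma> \<in> Sym m \<Longrightarrow> permutation \<sigma>"
  using permutation_permutes by (auto simp: Sym_def)

text \<open>The product of the row symmetrizer, \<open>t\<close> and the column antisymmetrizer in
  the group algebra. This is what arises from left multiplication of the Young symmetrizer by a
  class sum once the sum has been moved past the row symmetrizer.\<close>

definition twisted_symmetrizer :: "diagram \<Rightarrow> (nat \<Rightarrow> nat) \<Rightarrow> (nat \<Rightarrow> nat) \<Rightarrow> complex" where
  "twisted_symmetrizer \<nu> t =
     (\<lambda>\<tau>. \<Sum>p\<in>row_group \<nu>. \<Sum>q\<in>column_group \<nu>. if \<tau> = p \<circ> t \<circ> q then of_int (sign q) else 0)"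

lemma twisted_symmetrizer_id: "twisted_symmetrizer \<nu> id = young_symmetrizer \<nu>"
  by (simp add: twisted_symmetrizer_def young_symmetrizer_def)

text \<open>Right multiplication by an involution of the row group permutes the row group, so the
  row symmetrizer absorbs it.\<close>

lemma twisted_symmetrizer_row:
  assumes "transpose a b \<in> row_group \<nu>"
  shows "twisted_symmetrizer \<nu> (transpose a b \<circ> t) = twisted_symmetrizer \<nu> t"
proof
  fix \<tau>
  let ?u = "transpose a b"
  have bij: "bij_betw (\<lambda>p. p \<circ> ?u) (row_group \<nu>) (row_group \<nu>)"
    by (rule bij_betwI[where g = "\<lambda>p. p \<circ> ?u"]) (auto simp: row_group_comp assms comp_assoc)
  show "twisted_symmetrizer \<nu> (?u \<circ> t) \<tau> = twisted_symmetrizer \<nu> t \<tau>"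
    unfolding twisted_symmetrizer_def comp_assoc[symmetric]
    by (rule sum.reindex_bij_betw[OF bij])
qed

text \<open>Left multiplication by the transposition permutes the column group and flips every sign;
  \<open>a \<noteq> b\<close> makes the transposition odd.\<close>

lemma twisted_symmetrizer_column:
  assumes "transpose a b \<in> column_group \<nu>" "a \<noteq> b"
  shows "twisted_symmetrizer \<nu> (t \<circ> transpose a b) = - twisted_symmetrizer \<nu> t"
proof
  fix \<tau>
  let ?u = "transpose a b"
  have bij: "bij_betw (\<lambda>q. ?u \<circ> q) (column_group \<nu>) (column_group \<nu>)"
    by (rule bij_betwI[where g = "\<lambda>q. ?u \<circ> q"]) (auto simp: column_group_comp assms comp_assoc[symmetric])
  have sgn: "sign q = - sign (?u \<circ> q)" if "q \<in> column_group \<nu>" for q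
    using that assms(2) sign_compose[of ?u q] Sym_permutation[of q "card \<nu>"]
    by (simp add: column_group_def permutation_swap_id sign_swap_id)
  have "(\<Sum>q\<in>column_group \<nu>. if \<tau> = p \<circ> (t \<circ> ?u) \<circ> q then of_int (sign q) else 0)
      = (\<Sum>q\<in>column_group \<nu>. if \<tau> = p \<circ> t \<circ> q then - of_int (sign q) else (0::complex))" for p :: "nat \<Rightarrow> nat"
  proof -
    have "(\<Sum>q\<in>column_group \<nu>. if \<tau> = p \<circ> (t \<circ> ?u) \<circ> q then of_int (sign q) else 0)
      = (\<Sum>q\<in>column_group \<nu>. if \<tau> = p \<circ> t \<circ> (?u \<circ> q) then - of_int (sign (?u \<circ> q)) else (0::complex))"
      by (rule sum.cong) (auto simp: comp_assoc sgn)
    also have "\<dots> = (\<Sum>q\<in>column_group \<nu>. if \<tau> = p \<circ> t \<circ> q then - of_int (sign q) else (0::complex))"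
      by (rule sum.reindex_bij_betw[OF bij])
    finally show ?thesis .
  qed
  then show "twisted_symmetrizer \<nu> (t \<circ> ?u) \<tau> = (- twisted_symmetrizer \<nu> t) \<tau>"
    unfolding twisted_symmetrizer_def
    by (simp add: sum_negf[symmetric] if_distrib[of uminus] cong: if_cong)
qed

text \<open>If \<open>x = (r, c)\<close> and \<open>y = (r', c')\<close> with \<open>r < r'\<close> and \<open>c \<noteq> c'\<close>, then \<open>z = (r, c')\<close> is a box,
  and the transposition of \<open>x\<close> and \<open>y\<close> carries the row pair \<open>z, x\<close> to the column pair \<open>z, y\<close>.\<close>

lemma twisted_symmetrizer_oblique:
  assumes \<nu>: "young_diagram \<nu>" and x: "x \<in> \<nu>" and y: "y \<in> \<nu>" and lt: "fst x < fst y" and ne: "snd x \<noteq> snd y"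
  shows "twisted_symmetrizer \<nu> (transpose (row_filling \<nu> x) (row_filling \<nu> y)) = 0"
proof -
  let ?rf = "row_filling \<nu>"
  define z where "z = (fst x, snd y)"
  have fin: "finite \<nu>" using \<nu> by (simp add: young_diagram_def)
  have z: "z \<in> \<nu>"
    using \<nu> y lt unfolding young_diagram_def z_def by (metis order.refl less_imp_le prod.collapse)
  have inj: "inj_on ?rf \<nu>" using row_filling_bij[OF fin] by (simp add: bij_betw_def)
  have "z \<noteq> x" "z \<noteq> y" "x \<noteq> y"
    using lt ne by (auto simp: z_def prod_eq_iff)
  then have dist: "?rf z \<noteq> ?rf x" "?rf z \<noteq> ?rf y" "?rf x \<noteq> ?rf y"
    using x y z by (simp_all add: inj_on_eq_iff[OF inj])
  let ?t = "transpose (?rf x) (?rf y)"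
  have row: "transpose (?rf z) (?rf x) \<in> row_group \<nu>"
    using fin z x by (intro transpose_mem_row_group) (auto simp: z_def)
  have col: "transpose (?rf z) (?rf y) \<in> column_group \<nu>"
    using fin z y by (intro transpose_mem_column_group) (auto simp: z_def)
  \<comment> \<open>By this identity one element arises both by absorbing a row transposition and by
    absorbing a column transposition, so it equals its own negative.\<close>
  have "transpose (?rf z) (?rf x) \<circ> ?t = ?t \<circ> transpose (?rf z) (?rf y)"
    using dist by (auto simp: fun_eq_iff transpose_def)
  then have "twisted_symmetrizer \<nu> ?t = - twisted_symmetrizer \<nu> ?t"
    using twisted_symmetrizer_row[OF row, of ?t] twisted_symmetrizer_column[OF col dist(2), of ?t] by simp
  note neg = this
  have "twisted_symmetrizer \<nu> ?t \<tau> = 0" for \<tau>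
    using fun_cong[OF neg, of \<tau>] by (simp add: complex_eq_iff)
  then show ?thesis by (simp add: fun_eq_iff)
qed

text \<open>Summing over all ordered pairs of entries, equal ones included, the class sum of the
  transpositions acts on \<open>specht \<nu>\<close> by twice the content sum of \<open>\<nu>\<close> plus \<open>card \<nu>\<close>.\<close>

definition pair_eigenvalue :: "diagram \<Rightarrow> int" where
  "pair_eigenvalue \<nu> = int (card {(x, y). x \<in> \<nu> \<and> y \<in> \<nu> \<and> fst x = fst y})
     - int (card {(x, y). x \<in> \<nu> \<and> y \<in> \<nu> \<and> x \<noteq> y \<and> snd x = snd y})"

text \<open>In one row the transposition is absorbed, in one column it is absorbed with a sign, and
  in oblique position everything cancels. The case \<open>x = y\<close> counts as a row pair, hence
  the condition \<open>x \<noteq> y\<close> in the column indicator.\<close>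

lemma twisted_symmetrizer_transpose:
  assumes \<nu>: "young_diagram \<nu>" and x: "x \<in> \<nu>" and y: "y \<in> \<nu>"
  shows "twisted_symmetrizer \<nu> (transpose (row_filling \<nu> x) (row_filling \<nu> y)) \<tau>
    = ((if fst x = fst y then 1 else 0) - (if x \<noteq> y \<and> snd x = snd y then 1 else 0)) * young_symmetrizer \<nu> \<tau>"
proof -
  have fin: "finite \<nu>" using \<nu> by (simp add: young_diagram_def)
  consider "fst x = fst y" | "fst x \<noteq> fst y" "snd x = snd y" | "fst x < fst y" "snd x \<noteq> snd y"
    | "fst y < fst x" "snd x \<noteq> snd y" by linarith
  then show ?thesis
  proof cases
    case 1
    then have "\<not> (x \<noteq> y \<and> snd x = snd y)" by (auto simp: prod_eq_iff)
    then show ?thesis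
      unfolding if_not_P[OF \<open>\<not> _\<close>]
      using 1 twisted_symmetrizer_row[OF transpose_mem_row_group[OF fin x y 1], of id]
      by (simp add: twisted_symmetrizer_id)
  next
    case 2
    then have "row_filling \<nu> x \<noteq> row_filling \<nu> y"
      using row_filling_bij[OF fin] x y by (auto simp: bij_betw_def inj_on_def)
    from twisted_symmetrizer_column[OF transpose_mem_column_group[OF fin x y 2(2)] this, of id] 2
    show ?thesis by (auto simp: twisted_symmetrizer_id)
  next
    case 3
    then show ?thesis using twisted_symmetrizer_oblique[OF \<nu> x y] by auto
  next
    case 4
    then show ?thesis using twisted_symmetrizer_oblique[OF \<nu> y x] by (auto simp: transpose_commute)
  qed
qed

text \<open>For each row permutation \<open>p\<close>, a transposition \<open>t\<close> satisfies
  \<open>t p = p (inv p t p)\<close>, and by centrality the conjugation disappears after summation.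
  The transpositions then stand between the two symmetrizers, where each contributes 1, -1 or
  0.\<close>

lemma sum_transpose_young_symmetrizer:
  assumes \<nu>: "young_diagram \<nu>"
  shows "(\<Sum>a\<in>{1..card \<nu>}. \<Sum>b\<in>{1..card \<nu>}. young_symmetrizer \<nu> (transpose a b \<circ> \<tau>))
    = of_int (pair_eigenvalue \<nu>) * young_symmetrizer \<nu> \<tau>"
proof -
  let ?A = "{1..card \<nu>}" and ?R = "row_group \<nu>" and ?C = "column_group \<nu>" and ?rf = "row_filling \<nu>"
  define G :: "(nat \<Rightarrow> nat) \<Rightarrow> (nat \<Rightarrow> nat) \<Rightarrow> complex" where
    "G p t = (\<Sum>q\<in>?C. if \<tau> = p \<circ> t \<circ> q then of_int (sign q) else 0)" for p t
  have fin: "finite \<nu>" using \<nu> by (simp add: young_diagram_def)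
  have bij: "bij_betw ?rf \<nu> ?A" by (rule row_filling_bij[OF fin])
  have move: "transpose a b \<circ> \<tau> = \<rho> \<longleftrightarrow> \<tau> = transpose a b \<circ> \<rho>" for a b :: nat and \<rho>
    by (metis comp_assoc comp_id id_comp transpose_comp_involutory)
  have "(\<Sum>a\<in>?A. \<Sum>b\<in>?A. young_symmetrizer \<nu> (transpose a b \<circ> \<tau>))
      = (\<Sum>a\<in>?A. \<Sum>b\<in>?A. \<Sum>p\<in>?R. G p (inv p \<circ> transpose a b \<circ> p))"
  proof (intro sum.cong refl)
    fix a b
    have "p \<circ> (inv p \<circ> transpose a b \<circ> p) = transpose a b \<circ> p" if "p \<in> ?R" for p
      using that by (auto simp: row_group_def Sym_def comp_assoc[symmetric] permutes_inv_o)
    then show "young_symmetrizer \<nu> (transpose a b \<circ> \<tau>) = (\<Sum>p\<in>?R. G p (inv p \<circ> transpose a b \<circ> p))"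
      unfolding young_symmetrizer_def G_def move by (simp add: comp_assoc)
  qed
  also have "\<dots> = (\<Sum>a\<in>?A. \<Sum>p\<in>?R. \<Sum>b\<in>?A. G p (inv p \<circ> transpose a b \<circ> p))"
    by (intro sum.cong refl) (rule sum.swap)
  also have "\<dots> = (\<Sum>p\<in>?R. \<Sum>a\<in>?A. \<Sum>b\<in>?A. G p (inv p \<circ> transpose a b \<circ> p))"
    by (rule sum.swap)
  \<comment> \<open>The sum over \<open>p\<close> was brought outside so that centrality applies for
    each fixed \<open>p\<close>.\<close>
  also have "\<dots> = (\<Sum>p\<in>?R. \<Sum>a\<in>?A. \<Sum>b\<in>?A. G p (transpose a b))"
    by (intro sum.cong refl sum_transpose_conj) (auto simp: row_group_def Sym_def)
  also have "\<dots> = (\<Sum>a\<in>?A. \<Sum>p\<in>?R. \<Sum>b\<in>?A. G p (transpose a b))"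
    by (rule sum.swap)
  also have "\<dots> = (\<Sum>a\<in>?A. \<Sum>b\<in>?A. \<Sum>p\<in>?R. G p (transpose a b))"
    by (intro sum.cong refl) (rule sum.swap)
  also have "\<dots> = (\<Sum>a\<in>?A. \<Sum>b\<in>?A. twisted_symmetrizer \<nu> (transpose a b) \<tau>)"
    by (simp add: G_def twisted_symmetrizer_def)
  \<comment> \<open>From here on entries are replaced by the boxes containing them.\<close>
  also have "\<dots> = (\<Sum>a\<in>?A. \<Sum>y\<in>\<nu>. twisted_symmetrizer \<nu> (transpose a (?rf y)) \<tau>)"
    by (intro sum.cong refl) (rule sum.reindex_bij_betw[OF bij, symmetric])
  also have "\<dots> = (\<Sum>x\<in>\<nu>. \<Sum>y\<in>\<nu>. twisted_symmetrizer \<nu> (transpose (?rf x) (?rf y)) \<tau>)"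
    by (rule sum.reindex_bij_betw[OF bij, symmetric])
  also have "\<dots> = (\<Sum>x\<in>\<nu>. \<Sum>y\<in>\<nu>. ((if fst x = fst y then 1 else 0)
      - (if x \<noteq> y \<and> snd x = snd y then 1 else 0)) * young_symmetrizer \<nu> \<tau>)"
    using twisted_symmetrizer_transpose[OF \<nu>] by simp
  also have "\<dots> = (\<Sum>(x, y)\<in>\<nu> \<times> \<nu>. (if fst x = fst y then 1 else 0)
      - (if x \<noteq> y \<and> snd x = snd y then 1 else 0)) * young_symmetrizer \<nu> \<tau>"
    by (simp add: sum.cartesian_product sum_distrib_right split_def)
  also have "(\<Sum>(x, y)\<in>\<nu> \<times> \<nu>. (if fst x = fst y then 1 else 0)
      - (if x \<noteq> y \<and> snd x = snd y then 1 else 0)) = (of_int (pair_eigenvalue \<nu>) :: complex)"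
  proof -
    have count: "(\<Sum>z\<in>\<nu> \<times> \<nu>. if Q z then 1 else 0) = (of_nat (card {z \<in> \<nu> \<times> \<nu>. Q z}) :: complex)" for Q
      using fin by (simp add: sum.If_cases Int_def)
    have eq: "{z \<in> \<nu> \<times> \<nu>. fst (fst z) = fst (snd z)} = {(x, y). x \<in> \<nu> \<and> y \<in> \<nu> \<and> fst x = fst y}"
      "{z \<in> \<nu> \<times> \<nu>. fst z \<noteq> snd z \<and> snd (fst z) = snd (snd z)}
        = {(x, y). x \<in> \<nu> \<and> y \<in> \<nu> \<and> x \<noteq> y \<and> snd x = snd y}"
      by auto
    show ?thesis
      unfolding split_def sum_subtractf count eq[unfolded split_def] by (simp add: pair_eigenvalue_def split_def)
  qed
  finally show ?thesis .
qed

section \<open>Class sums on Specht modules\<close>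

lemma left_mult_left_mult:
  assumes "bij \<sigma>" "bij \<rho>"
  shows "left_mult \<sigma> (left_mult \<rho> u) = left_mult (\<sigma> \<circ> \<rho>) u"
  using assms by (simp add: left_mult_def o_inv_distrib comp_assoc)

lemma left_mult_add: "left_mult \<sigma> (u + v) = left_mult \<sigma> u + left_mult \<sigma> v"
  and left_mult_cscale: "left_mult \<sigma> (cscale a u) = cscale a (left_mult \<sigma> u)"
  and left_mult_zero: "left_mult \<sigma> 0 = 0"
  by (auto simp: left_mult_def fun_eq_iff)

lemma left_mult_mem_specht:
  assumes "\<sigma> \<in> Sym (card \<nu>)" "u \<in> specht \<nu>"
  shows "left_mult \<sigma> u \<in> specht \<nu>"
  using assms(2) unfolding specht_def
proof (induction rule: cfun.span_induct_alt)
  case base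
  then show ?case by (simp only: left_mult_zero cfun.span_zero)
next
  case (step a x y)
  then obtain \<rho> where \<rho>: "\<rho> \<in> Sym (card \<nu>)" "x = left_mult \<rho> (young_symmetrizer \<nu>)" by blast
  have "\<sigma> \<circ> \<rho> \<in> Sym (card \<nu>)" using assms(1) \<rho>(1) by (simp add: Sym_def permutes_compose)
  moreover have "left_mult \<sigma> x = left_mult (\<sigma> \<circ> \<rho>) (young_symmetrizer \<nu>)"
    using assms(1) \<rho> by (simp add: left_mult_left_mult Sym_def permutes_bij)
  ultimately have "left_mult \<sigma> x \<in> cfun.span ((\<lambda>\<sigma>. left_mult \<sigma> (young_symmetrizer \<nu>)) ` Sym (card \<nu>))"
    using cfun.span_base[OF imageI] by simp
  with step(2) show ?case
    unfolding left_mult_add left_mult_cscale by (intro cfun.span_add cfun.span_scale)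
qed

text \<open>The generators are left translates of the Young symmetrizer, and the class sum commutes
  with the translation; linearity does the rest.\<close>

lemma sum_left_mult_transpose_specht:
  assumes \<nu>: "young_diagram \<nu>" and u: "u \<in> specht \<nu>"
  shows "(\<Sum>a\<in>{1..card \<nu>}. \<Sum>b\<in>{1..card \<nu>}. left_mult (transpose a b) u)
    = cscale (of_int (pair_eigenvalue \<nu>)) u"
  using u unfolding specht_def
proof (induction rule: cfun.span_induct_alt)
  case base
  show ?case by (simp only: left_mult_zero) (simp add: fun_eq_iff)
next
  case (step c x y)
  let ?A = "{1..card \<nu>}"
  obtain \<sigma> where \<sigma>: "\<sigma> permutes ?A" "x = left_mult \<sigma> (young_symmetrizer \<nu>)"
    using step(1) by (auto simp: Sym_def)
  have "(\<Sum>a\<in>?A. \<Sum>b\<in>?A. left_mult (transpose a b) x) \<tau> = of_int (pair_eigenvalue \<nu>) * x \<tau>" for \<tau>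
  proof -
    \<comment> \<open>Inserting \<open>\<sigma> \<circ> inv \<sigma>\<close> turns the transposition
      into a conjugate, to which \<open>sum_transpose_conj\<close> applies.\<close>
    have "inv \<sigma> \<circ> (\<rho> \<circ> \<tau>) = inv \<sigma> \<circ> \<rho> \<circ> \<sigma> \<circ> (inv \<sigma> \<circ> \<tau>)" for \<rho>
      using permutes_inverses[OF \<sigma>(1)] by (simp add: fun_eq_iff)
    then have "(\<Sum>a\<in>?A. \<Sum>b\<in>?A. left_mult (transpose a b) x) \<tau>
        = (\<Sum>a\<in>?A. \<Sum>b\<in>?A. young_symmetrizer \<nu> (inv \<sigma> \<circ> transpose a b \<circ> \<sigma> \<circ> (inv \<sigma> \<circ> \<tau>)))"
      by (simp add: sum_fun_apply left_mult_def \<sigma>(2))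
    also have "\<dots> = (\<Sum>a\<in>?A. \<Sum>b\<in>?A. young_symmetrizer \<nu> (transpose a b \<circ> (inv \<sigma> \<circ> \<tau>)))"
      by (rule sum_transpose_conj[OF \<sigma>(1), of "\<lambda>t. young_symmetrizer \<nu> (t \<circ> (inv \<sigma> \<circ> \<tau>))"])
    also have "\<dots> = of_int (pair_eigenvalue \<nu>) * x \<tau>"
      unfolding sum_transpose_young_symmetrizer[OF \<nu>] by (simp add: \<sigma>(2) left_mult_def)
    finally show ?thesis .
  qed
  then have x: "(\<Sum>a\<in>?A. \<Sum>b\<in>?A. left_mult (transpose a b) x) = cscale (of_int (pair_eigenvalue \<nu>)) x"
    by blast
  have "(\<Sum>a\<in>?A. \<Sum>b\<in>?A. left_mult (transpose a b) (cscale c x + y))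
      = cscale c (\<Sum>a\<in>?A. \<Sum>b\<in>?A. left_mult (transpose a b) x)
        + (\<Sum>a\<in>?A. \<Sum>b\<in>?A. left_mult (transpose a b) y)"
    unfolding left_mult_add left_mult_cscale
    by (rule ext) (simp add: sum_fun_apply sum.distrib sum_distrib_left)
  also have "\<dots> = cscale (of_int (pair_eigenvalue \<nu>)) (cscale c x + y)"
    unfolding x step(2) by (simp add: fun_eq_iff algebra_simps)
  finally show ?case .
qed

section \<open>Transpositions acting on functions on words\<close>

lemma length_act_word [simp]: "length (act_word \<sigma> w) = length w"
  by (simp add: act_word_def del: upt_Suc)

lemma nth_act_word: "j < length w \<Longrightarrow> act_word \<sigma> w ! j = w ! (inv \<sigma> (Suc j) - 1)"
  by (simp add: act_word_def del: upt_Suc)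

lemma act_word_comp:
  assumes "\<sigma> permutes {1..length w}" "\<tau> permutes {1..length w}"
  shows "act_word \<sigma> (act_word \<tau> w) = act_word (\<sigma> \<circ> \<tau>) w"
proof (rule nth_equalityI)
  fix j assume j: "j < length (act_word \<sigma> (act_word \<tau> w))"
  \<comment> \<open>Permutations act on positions counted from 1, list indices start at 0;
    membership in this range keeps the truncated subtraction exact.\<close>
  have "inv \<sigma> (Suc j) \<in> {1..length w}"
    using j permutes_in_image[OF permutes_inv[OF assms(1)]] by simp
  moreover from this have "inv \<sigma> (Suc j) - 1 < length w" "Suc (inv \<sigma> (Suc j) - 1) = inv \<sigma> (Suc j)"
    by auto
  ultimately show "act_word \<sigma> (act_word \<tau> w) ! j = act_word (\<sigma> \<circ> \<tau>) w ! j"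
    using j assms by (simp add: nth_act_word o_inv_distrib permutes_bij)
qed simp

lemma act_word_id: "act_word id w = w"
  by (rule nth_equalityI) (auto simp: nth_act_word)

lemma mset_act_word:
  assumes "\<sigma> permutes {1..length w}"
  shows "mset (act_word \<sigma> w) = mset w"
proof -
  let ?A = "{1..length w}"
  have word: "image_mset (\<lambda>j. w ! (j - 1)) (mset_set ?A) = mset w"
  proof -
    have "map (\<lambda>j. w ! (j - 1)) [1..<length w + 1] = w"
      by (rule nth_equalityI) (auto simp del: upt_Suc)
    then have "mset w = mset (map (\<lambda>j. w ! (j - 1)) [1..<length w + 1])" by simp
    also have "\<dots> = image_mset (\<lambda>j. w ! (j - 1)) (mset_set ?A)"
      unfolding mset_map mset_upt by (simp add: atLeastLessThanSuc_atLeastAtMost)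
    finally show ?thesis by simp
  qed
  have "mset (act_word \<sigma> w) = image_mset (\<lambda>j. w ! (inv \<sigma> j - 1)) (mset_set ?A)"
    unfolding act_word_def mset_map mset_upt by (simp add: atLeastLessThanSuc_atLeastAtMost)
  also have "\<dots> = image_mset (\<lambda>j. w ! (j - 1)) (image_mset (inv \<sigma>) (mset_set ?A))"
    by (simp add: multiset.map_comp o_def)
  also have "image_mset (inv \<sigma>) (mset_set ?A) = mset_set ?A"
    using permutes_inv[OF assms] by (simp add: image_mset_mset_set permutes_inj_on permutes_image)
  finally show ?thesis using word by simp
qed

lemma act_word_mem_words:
  assumes "\<sigma> permutes {1..n}"
  shows "act_word \<sigma> w \<in> words n k \<longleftrightarrow> w \<in> words n k"
proof (cases "length w = n")
  case True
  then have "mset (act_word \<sigma> w) = mset w" using assms by (simp add: mset_act_word)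
  then have "set (act_word \<sigma> w) = set w" "count_list (act_word \<sigma> w) 1 = count_list w 1"
    by (metis set_mset_mset, metis count_mset)
  then show ?thesis by (simp add: words_def)
qed (simp add: words_def)

lemma drop_act_word:
  assumes "\<sigma> permutes {1..m}"
  shows "drop m (act_word \<sigma> w) = drop m w"
proof (rule nth_equalityI)
  fix j assume j: "j < length (drop m (act_word \<sigma> w))"
  have "inv \<sigma> (Suc (m + j)) = Suc (m + j)"
    using permutes_not_in[OF permutes_inv[OF assms]] by simp
  then show "drop m (act_word \<sigma> w) ! j = drop m w ! j"
    using j by (simp add: nth_act_word)
qed simp

lemma act_add: "act \<sigma> (f + g) = act \<sigma> f + act \<sigma> g"
  and act_cscale: "act \<sigma> (cscale c f) = cscale c (act \<sigma> f)"
  and act_zero: "act \<sigma> 0 = 0"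
  and act_id: "act id f = f"
  by (auto simp: act_def fun_eq_iff act_word_id)

lemma act_sum: "act \<sigma> (\<Sum>x\<in>A. f x) = (\<Sum>x\<in>A. act \<sigma> (f x))"
  by (rule ext) (simp add: act_def sum_fun_apply)

lemma Fun_apply_length: "f \<in> Fun n k \<Longrightarrow> length w \<noteq> n \<Longrightarrow> f w = 0"
  by (auto simp: Fun_def words_def)

lemma subspace_Fun: "cfun.subspace (Fun n k)"
  by (auto simp: cfun.subspace_def Fun_def)

lemma act_mem_Fun:
  assumes "f \<in> Fun n k" "\<sigma> permutes {1..n}"
  shows "act \<sigma> f \<in> Fun n k"
  using assms act_word_mem_words[OF permutes_inv[OF assms(2)]] by (auto simp: act_def Fun_def)

text \<open>On words of length \<open>n\<close> this is the composition law for
  \<open>act_word\<close>. On other lengths both sides vanish, since \<open>act_word\<close>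
  preserves the length and \<open>f\<close> is zero there.\<close>

lemma act_comp:
  assumes "f \<in> Fun n k" "\<sigma> permutes {1..n}" "\<tau> permutes {1..n}"
  shows "act \<sigma> (act \<tau> f) = act (\<sigma> \<circ> \<tau>) f"
proof
  fix w
  show "act \<sigma> (act \<tau> f) w = act (\<sigma> \<circ> \<tau>) f w"
  proof (cases "length w = n")
    case True
    then have "act_word (inv \<tau>) (act_word (inv \<sigma>) w) = act_word (inv (\<sigma> \<circ> \<tau>)) w"
      using act_word_comp[of "inv \<tau>" w "inv \<sigma>"] assms(2,3)
      by (simp add: permutes_inv o_inv_distrib permutes_bij)
    then show ?thesis by (simp add: act_def)
  qed (simp add: act_def Fun_apply_length[OF assms(1)])
qed

section \<open>The set of words and the inner product\<close>

lemma finite_words [simp]: "finite (words n k)"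
proof -
  have "words n k \<subseteq> {w. set w \<subseteq> {1, 2} \<and> length w = n}" by (auto simp: words_def)
  then show ?thesis by (rule finite_subset) (simp add: finite_lists_length_eq)
qed

text \<open>A word is determined by the positions of its letters 1, because the only other letter is
  2.\<close>

lemma card_words_le: "card (words n k) \<le> n choose k"
proof -
  let ?pos = "\<lambda>w. {j. j < n \<and> w ! j = (1::nat)}"
  have "inj_on ?pos (words n k)"
  proof (rule inj_onI)
    fix v w assume v: "v \<in> words n k" and w: "w \<in> words n k" and eq: "?pos v = ?pos w"
    show "v = w"
    proof (rule nth_equalityI)
      show "length v = length w" using v w by (simp add: words_def)
      fix j assume j: "j < length v"
      have "length w = length v" "set v \<subseteq> {1, 2}" "set w \<subseteq> {1, 2}" "j < n"
        using v w j unfolding words_def by auto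
      then have "v ! j \<in> {1, 2}" "w ! j \<in> {1, 2}"
        using j by (metis nth_mem subsetD)+
      moreover have "v ! j = 1 \<longleftrightarrow> w ! j = 1" using eq \<open>j < n\<close> by blast
      ultimately show "v ! j = w ! j" by auto
    qed
  qed
  moreover have "?pos ` words n k \<subseteq> {A. A \<subseteq> {..<n} \<and> card A = k}"
  proof (rule image_subsetI, clarify, intro conjI)
    fix w assume "w \<in> words n k"
    then show "card (?pos w) = k"
      by (auto simp: words_def count_list_eq_length_filter length_filter_conv_card intro!: arg_cong[where f = card])
  qed auto
  ultimately have "card (words n k) \<le> card {A. A \<subseteq> {..<n} \<and> card A = k}"
    by (rule card_inj_on_le) (simp add: finite_subset[of _ "Pow {..<n}"] subset_eq)
  then show ?thesis by (simp add: n_subsets)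
qed

text \<open>A transposition permutes the words and is its own inverse, so reindexing moves it to the
  other argument.\<close>

lemma inner_F_act_transpose:
  assumes "a \<in> {1..n}" "b \<in> {1..n}"
  shows "inner_F n k (act (transpose a b) f) g = inner_F n k f (act (transpose a b) g)"
proof -
  let ?t = "act_word (transpose a b)"
  have perm: "transpose a b permutes {1..n}" using assms by (rule permutes_swap_id)
  have invol: "?t (?t w) = w" if "w \<in> words n k" for w
    using that perm by (simp add: words_def act_word_comp act_word_id)
  have bij: "bij_betw ?t (words n k) (words n k)"
    by (rule bij_betwI[where g = ?t]) (auto simp: invol act_word_mem_words[OF perm])
  have "inner_F n k (act (transpose a b) f) g = (\<Sum>w\<in>words n k. f (?t w) * cnj (g (?t (?t w))))"
    unfolding inner_F_def act_def by (rule sum.cong) (auto simp: invol)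
  also have "\<dots> = (\<Sum>w\<in>words n k. f w * cnj (g (?t w)))"
    by (rule sum.reindex_bij_betw[OF bij])
  finally show ?thesis by (simp add: inner_F_def act_def)
qed

lemma inner_F_add_left: "inner_F n k (f + g) h = inner_F n k f h + inner_F n k g h"
  and inner_F_cscale_left: "inner_F n k (cscale c f) h = c * inner_F n k f h"
  and inner_F_cscale_right: "inner_F n k f (cscale c h) = cnj c * inner_F n k f h"
  and inner_F_cnj: "cnj (inner_F n k f h) = inner_F n k h f"
  and inner_F_zero_left: "inner_F n k 0 h = 0"
  by (simp_all add: inner_F_def sum.distrib[symmetric] sum_distrib_left algebra_simps)

lemma inner_F_sum_left: "inner_F n k (\<Sum>x\<in>A. f x) h = (\<Sum>x\<in>A. inner_F n k (f x) h)"
  by (induction A rule: infinite_finite_induct)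
    (simp_all only: sum.infinite sum.empty sum.insert inner_F_add_left inner_F_zero_left not_False_eq_True)

lemma inner_F_sum_right: "inner_F n k h (\<Sum>x\<in>A. f x) = (\<Sum>x\<in>A. inner_F n k h (f x))"
proof -
  have "inner_F n k h (\<Sum>x\<in>A. f x) = cnj (inner_F n k (\<Sum>x\<in>A. f x) h)" by (simp only: inner_F_cnj)
  then show ?thesis by (simp add: inner_F_sum_left inner_F_cnj)
qed

section \<open>Class sums and Jucys-Murphy elements on functions\<close>

definition class_sum :: "nat \<Rightarrow> (nat list \<Rightarrow> complex) \<Rightarrow> nat list \<Rightarrow> complex" where
  "class_sum j f = (\<Sum>a\<in>{1..j}. \<Sum>b\<in>{1..j}. act (transpose a b) f)"

lemma class_sum_add: "class_sum j (f + g) = class_sum j f + class_sum j g"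
  by (simp add: class_sum_def act_add sum.distrib)

lemma class_sum_cscale: "class_sum j (cscale c f) = cscale c (class_sum j f)"
  by (rule ext) (simp add: class_sum_def act_cscale sum_fun_apply sum_distrib_left)

text \<open>Each generating submodule is the image of the Specht module under an equivariant linear
  bijection, which transports the scalar found there.\<close>

lemma class_sum_isotypic:
  assumes \<nu>: "young_diagram \<nu>" and f: "f \<in> isotypic n k \<nu>"
  shows "class_sum (card \<nu>) f = cscale (of_int (pair_eigenvalue \<nu>)) f"
  using f unfolding isotypic_def
proof (induction rule: cfun.span_induct_alt)
  case base
  show ?case by (simp only: class_sum_def act_zero) (simp add: fun_eq_iff)
next
  case (step c x y)
  let ?A = "{1..card \<nu>}" and ?e = "of_int (pair_eigenvalue \<nu>) :: complex"
  obtain W where x: "x \<in> W" and iso: "iso_to_specht \<nu> W"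
    using step(1) by auto
  obtain \<phi> where bij: "bij_betw \<phi> (specht \<nu>) W"
    and \<phi>: "\<forall>u\<in>specht \<nu>. \<forall>v\<in>specht \<nu>. \<phi> (u + v) = \<phi> u + \<phi> v"
      "\<forall>a. \<forall>u\<in>specht \<nu>. \<phi> (cscale a u) = cscale a (\<phi> u)"
      "\<forall>\<sigma>\<in>Sym (card \<nu>). \<forall>u\<in>specht \<nu>. \<phi> (left_mult \<sigma> u) = act \<sigma> (\<phi> u)"
    using iso unfolding iso_to_specht_def by (elim exE conjE)
  note add = \<phi>(1)[rule_format] and scale = \<phi>(2)[rule_format] and equivariant = \<phi>(3)[rule_format]
  obtain u where u: "u \<in> specht \<nu>" "x = \<phi> u"
    using bij x by (auto simp: bij_betw_def)
  have zero: "(0 :: (nat \<Rightarrow> nat) \<Rightarrow> complex) \<in> specht \<nu>"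
    unfolding specht_def by (rule cfun.span_zero)
  have \<phi>0: "\<phi> 0 = 0" using add[OF zero zero] by simp
  \<comment> \<open>Additivity of \<open>\<phi>\<close> is known only on
    \<open>specht \<nu>\<close>, so the induction also carries the membership of the partial
    sums.\<close>
  have \<phi>_sum: "\<phi> (\<Sum>a\<in>B. g a) = (\<Sum>a\<in>B. \<phi> (g a)) \<and> (\<Sum>a\<in>B. g a) \<in> specht \<nu>"
    if "\<And>a. a \<in> B \<Longrightarrow> g a \<in> specht \<nu>" for g and B :: "nat set"
    using that
  proof (induction B rule: infinite_finite_induct)
    case (insert a B)
    then have "g a + (\<Sum>a\<in>B. g a) \<in> specht \<nu>"
      unfolding specht_def by (intro cfun.span_add) auto
    moreover have "\<phi> (g a + (\<Sum>a\<in>B. g a)) = \<phi> (g a) + (\<Sum>a\<in>B. \<phi> (g a))"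
      using insert by (subst add) auto
    ultimately show ?case
      unfolding sum.insert[OF insert(1,2)] by blast
  qed (simp_all only: sum.empty sum.infinite \<phi>0 zero simp_thms)
  have t: "transpose a b \<in> Sym (card \<nu>)" if "a \<in> ?A" "b \<in> ?A" for a b
    using that by (simp add: Sym_def permutes_swap_id)
  have mem: "left_mult (transpose a b) u \<in> specht \<nu>" if "a \<in> ?A" "b \<in> ?A" for a b
    by (rule left_mult_mem_specht[OF t[OF that] u(1)])
  have "class_sum (card \<nu>) x = (\<Sum>a\<in>?A. \<Sum>b\<in>?A. \<phi> (left_mult (transpose a b) u))"
    unfolding class_sum_def u(2) by (intro sum.cong refl) (simp add: equivariant[OF t u(1)])
  also have "\<dots> = (\<Sum>a\<in>?A. \<phi> (\<Sum>b\<in>?A. left_mult (transpose a b) u))"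
    by (intro sum.cong refl conjunct1[OF \<phi>_sum, symmetric]) (rule mem)
  also have "\<dots> = \<phi> (\<Sum>a\<in>?A. \<Sum>b\<in>?A. left_mult (transpose a b) u)"
    by (intro conjunct1[OF \<phi>_sum, symmetric] conjunct2[OF \<phi>_sum] mem)
  also have "\<dots> = cscale ?e x"
    unfolding sum_left_mult_transpose_specht[OF \<nu> u(1)] scale[OF u(1)] u(2) ..
  finally have "class_sum (card \<nu>) x = cscale ?e x" .
  then show ?case
    unfolding class_sum_add class_sum_cscale step(2) by (simp add: fun_eq_iff algebra_simps)
qed

text \<open>Among the new ordered pairs, those with exactly one entry \<open>Suc j\<close> give each
  transposition of the Jucys-Murphy element twice, and the pair with both entries equal to
  \<open>Suc j\<close> gives the identity.\<close>

lemma class_sum_Suc: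
  "class_sum (Suc j) f = class_sum j f + cscale 2 (jucys_murphy (Suc j) f) + f"
proof -
  have "{1..Suc j} = insert (Suc j) {1..j}" by auto
  then have "class_sum (Suc j) f = act (transpose (Suc j) (Suc j)) f + (\<Sum>b\<in>{1..j}. act (transpose (Suc j) b) f)
      + (\<Sum>a\<in>{1..j}. act (transpose a (Suc j)) f + (\<Sum>b\<in>{1..j}. act (transpose a b) f))"
    by (simp add: class_sum_def)
  also have "\<dots> = class_sum j f + ((\<Sum>a\<in>{1..j}. act (transpose a (Suc j)) f) + (\<Sum>a\<in>{1..j}. act (transpose a (Suc j)) f)) + f"
    by (simp add: class_sum_def sum.distrib act_id transpose_commute[of "Suc j"] algebra_simps)
  also have "\<dots> = class_sum j f + cscale 2 (jucys_murphy (Suc j) f) + f"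
    by (simp add: jucys_murphy_def atLeastLessThanSuc_atLeastAtMost fun_eq_iff)
  finally show ?thesis .
qed

lemma jucys_murphy_eigen:
  assumes "class_sum j f = cscale (of_int \<alpha>) f" "class_sum (Suc j) f = cscale (of_int \<beta>) f"
    and "\<beta> = \<alpha> + 2 * c + 1"
  shows "jucys_murphy (Suc j) f = cscale (of_int c) f"
proof
  fix w
  have "of_int \<beta> * f w = of_int \<alpha> * f w + 2 * jucys_murphy (Suc j) f w + f w"
    using fun_cong[OF class_sum_Suc[of j f], of w] assms(1,2) by simp
  then show "jucys_murphy (Suc j) f w = of_int c * f w"
    unfolding assms(3) by (simp add: algebra_simps)
qed

lemma inner_F_class_sum:
  assumes "j \<le> n"
  shows "inner_F n k (class_sum j f) g = inner_F n k f (class_sum j g)"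
  unfolding class_sum_def inner_F_sum_left inner_F_sum_right
  using assms by (intro sum.cong refl inner_F_act_transpose) auto

text \<open>Eigenvectors of a self-adjoint operator for different eigenvalues; integers are fixed by
  conjugation.\<close>

lemma inner_F_class_sum_eigen:
  assumes "j \<le> n" "class_sum j f = cscale (of_int \<alpha>) f" "class_sum j g = cscale (of_int \<beta>) g" "\<alpha> \<noteq> \<beta>"
  shows "inner_F n k f g = 0"
  using inner_F_class_sum[OF assms(1), of k f g] assms(4)
  unfolding assms(2,3) inner_F_cscale_left inner_F_cscale_right by simp

text \<open>The transposition of \<open>i\<close> and \<open>i + 1\<close> fixes every point up to
  \<open>j\<close>, so it commutes with all permutations in the class sum.\<close>

lemma class_sum_act_commute:
  assumes f: "f \<in> Fun n k" and "j < i" "i + 1 \<le> n"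
  shows "class_sum j (act (transpose i (i + 1)) f) = act (transpose i (i + 1)) (class_sum j f)"
proof -
  have "transpose a b \<circ> transpose i (i + 1) = transpose i (i + 1) \<circ> transpose a b"
    if "a \<in> {1..j}" "b \<in> {1..j}" for a b
    using that assms(2) by (auto simp: fun_eq_iff transpose_def)
  moreover have "transpose a b permutes {1..n}" if "a \<in> {1..j}" "b \<in> {1..j}" for a b
    using that assms(2,3) by (intro permutes_swap_id) auto
  moreover have "transpose i (i + 1) permutes {1..n}"
    using assms(2,3) by (intro permutes_swap_id) auto
  ultimately show ?thesis
    unfolding class_sum_def act_sum by (intro sum.cong refl) (simp add: act_comp[OF f])
qed

text \<open>Conjugation by \<open>(i i+1)\<close> turns \<open>(m i)\<close> into
  \<open>(m i+1)\<close> for \<open>m < i\<close>; the one remaining summand of the larger element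
  is \<open>(i i+1)\<close> itself.\<close>

lemma jucys_murphy_Suc:
  assumes f: "f \<in> Fun n k" and "1 \<le> i" "i + 1 \<le> n"
  shows "jucys_murphy (i + 1) f =
    act (transpose i (i + 1)) (jucys_murphy i (act (transpose i (i + 1)) f)) + act (transpose i (i + 1)) f"
proof -
  let ?s = "transpose i (i + 1)"
  have s: "?s permutes {1..n}" using assms(2,3) by (intro permutes_swap_id) auto
  have conj: "act ?s (act (transpose m i) (act ?s f)) = act (transpose m (i + 1)) f" if m: "m \<in> {1..<i}" for m
  proof -
    have t: "transpose m i permutes {1..n}" using m assms(2,3) by (intro permutes_swap_id) auto
    have "?s \<circ> (transpose m i \<circ> ?s) = transpose m (i + 1)"
      using m by (auto simp: fun_eq_iff transpose_def)
    then show ?thesis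
      using s t by (simp add: act_comp[OF f] permutes_compose)
  qed
  have "{1..<i + 1} = insert i {1..<i}" using assms(2) by auto
  then have "jucys_murphy (i + 1) f = act ?s f + (\<Sum>m\<in>{1..<i}. act (transpose m (i + 1)) f)"
    by (simp add: jucys_murphy_def)
  then show ?thesis
    unfolding jucys_murphy_def[of i] act_sum using conj by (simp add: add.commute)
qed

lemma jucys_murphy_cscale: "jucys_murphy j (cscale c f) = cscale c (jucys_murphy j f)"
  by (rule ext) (simp add: jucys_murphy_def act_cscale sum_fun_apply sum_distrib_left)

lemma jucys_murphy_sum: "jucys_murphy j (\<Sum>x\<in>A. f x) = (\<Sum>x\<in>A. jucys_murphy j (f x))"
  unfolding jucys_murphy_def act_sum by (rule sum.swap)

lemma jucys_murphy_mem_Fun: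
  assumes "f \<in> Fun n k" "j \<le> n"
  shows "jucys_murphy j f \<in> Fun n k"
  unfolding jucys_murphy_def
proof (intro cfun.subspace_sum[OF subspace_Fun] act_mem_Fun[OF assms(1)] permutes_swap_id)
qed (use assms in auto)

section \<open>Orthonormal bases\<close>

definition orthonormal_basis :: "nat \<Rightarrow> nat \<Rightarrow> label set \<Rightarrow> (label \<Rightarrow> nat list \<Rightarrow> complex) \<Rightarrow> bool" where
  "orthonormal_basis n k I b \<longleftrightarrow>
     (\<forall>x\<in>I. \<forall>y\<in>I. inner_F n k (b x) (b y) = (if x = y then 1 else 0)) \<and> cfun.span (b ` I) = Fun n k"

lemma orthonormal_inj_on:
  assumes "orthonormal_basis n k I b"
  shows "inj_on b I"
proof (rule inj_onI)
  fix x y assume "x \<in> I" "y \<in> I" "b x = b y"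
  then have "inner_F n k (b x) (b x) = 1" "inner_F n k (b x) (b x) = (if x = y then 1 else 0)"
    using assms unfolding orthonormal_basis_def by metis+
  then show "x = y" by (auto split: if_splits)
qed

lemma orthonormal_independent:
  assumes "orthonormal_basis n k I b"
  shows "cfun.independent (b ` I)"
  unfolding cfun.dependent_explicit
proof (intro notI, elim exE conjE bexE)
  fix T u v assume T: "finite T" "T \<subseteq> b ` I" and zero: "(\<Sum>v\<in>T. cscale (u v) v) = 0"
    and v: "v \<in> T" "u v \<noteq> 0"
  have orth: "inner_F n k v' v = (if v' = v then 1 else 0)" if v': "v' \<in> T" for v'
  proof -
    obtain x x' where "x \<in> I" "v = b x" "x' \<in> I" "v' = b x'"
      using v(1) v' T(2) by (meson imageE subsetD)
    then show ?thesis
      using assms orthonormal_inj_on[OF assms] by (simp add: orthonormal_basis_def inj_on_eq_iff)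
  qed
  \<comment> \<open>Pairing the linear relation with \<open>v\<close> isolates the coefficient of
    \<open>v\<close>.\<close>
  have "0 = inner_F n k (\<Sum>v\<in>T. cscale (u v) v) v"
    by (simp only: zero inner_F_zero_left)
  also have "\<dots> = (\<Sum>v'\<in>T. if v' = v then u v' else 0)"
    unfolding inner_F_sum_left inner_F_cscale_left by (rule sum.cong) (auto simp: orth)
  also have "\<dots> = u v" using T(1) v(1) by simp
  finally show False using v(2) by simp
qed

lemma Fun_subset_span_delta: "Fun n k \<subseteq> cfun.span (delta ` words n k)"
proof
  fix f assume f: "f \<in> Fun n k"
  have "f = (\<Sum>w\<in>words n k. cscale (f w) (delta w))"
  proof
    fix v
    have "(\<Sum>w\<in>words n k. cscale (f w) (delta w)) v = (\<Sum>w\<in>words n k. if v = w then f w else 0)"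
      unfolding sum_fun_apply by (rule sum.cong) (auto simp: delta_def)
    then show "f v = (\<Sum>w\<in>words n k. cscale (f w) (delta w)) v"
      using f by (auto simp: Fun_def)
  qed
  also have "\<dots> \<in> cfun.span (delta ` words n k)"
    by (intro cfun.span_sum cfun.span_scale cfun.span_base imageI)
  finally show "f \<in> cfun.span (delta ` words n k)" .
qed

text \<open>Used to bound the number of labels without counting chains of diagrams: a basis is an
  independent set in the span of the delta functions.\<close>

lemma orthonormal_finite_card:
  assumes "orthonormal_basis n k I b"
  shows "finite I" and "card I \<le> n choose k"
proof -
  have "b ` I \<subseteq> cfun.span (delta ` words n k)"
    using assms Fun_subset_span_delta cfun.span_superset[of "b ` I"]
    unfolding orthonormal_basis_def by blast
  then have fin: "finite (b ` I)" and le: "card (b ` I) \<le> card (delta ` words n k)"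
    using cfun.independent_span_bound[OF _ orthonormal_independent[OF assms], of "delta ` words n k"] by auto
  show "finite I" using fin orthonormal_inj_on[OF assms] by (rule finite_imageD)
  have "card I = card (b ` I)" using orthonormal_inj_on[OF assms] by (simp add: card_image)
  also have "\<dots> \<le> card (words n k)" using le card_image_le[of "words n k" delta] by simp
  also have "\<dots> \<le> n choose k" by (rule card_words_le)
  finally show "card I \<le> n choose k" .
qed

lemma representation_orthonormal:
  assumes ob: "orthonormal_basis n k I b" and f: "f \<in> Fun n k"
  shows "f = (\<Sum>x\<in>I. cscale (cfun.representation (b ` I) f (b x)) (b x))"
proof -
  have "(\<Sum>v\<in>b ` I. cscale (cfun.representation (b ` I) f v) v) = f"
    using orthonormal_independent[OF ob] f orthonormal_finite_card(1)[OF ob] ob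
    by (intro cfun.sum_representation_eq) (auto simp: orthonormal_basis_def)
  then show ?thesis by (simp add: sum.reindex[OF orthonormal_inj_on[OF ob]])
qed

lemma representation_eq_inner:
  assumes ob: "orthonormal_basis n k I b" and f: "f \<in> Fun n k" and x: "x \<in> I"
  shows "cfun.representation (b ` I) f (b x) = inner_F n k f (b x)"
proof -
  let ?r = "cfun.representation (b ` I) f"
  have "inner_F n k f (b x) = inner_F n k (\<Sum>y\<in>I. cscale (?r (b y)) (b y)) (b x)"
    by (subst representation_orthonormal[OF ob f]) (rule refl)
  also have "\<dots> = (\<Sum>y\<in>I. if y = x then ?r (b y) else 0)"
    unfolding inner_F_sum_left inner_F_cscale_left
    using ob x by (intro sum.cong) (auto simp: orthonormal_basis_def)
  also have "\<dots> = ?r (b x)" using x orthonormal_finite_card(1)[OF ob] by simp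
  finally show ?thesis by simp
qed

text \<open>\<open>J\<close> is meant to be a block, so that expansions have boundedly many
  terms.\<close>

lemma orthonormal_expansion:
  assumes ob: "orthonormal_basis n k I b" and f: "f \<in> Fun n k"
    and J: "J \<subseteq> I" "\<And>x. x \<in> I - J \<Longrightarrow> inner_F n k f (b x) = 0"
  shows "f = (\<Sum>x\<in>J. cscale (inner_F n k f (b x)) (b x))"
proof -
  have "f = (\<Sum>x\<in>I. cscale (inner_F n k f (b x)) (b x))"
    using representation_orthonormal[OF ob f] representation_eq_inner[OF ob f] by simp
  also have "\<dots> = (\<Sum>x\<in>J. cscale (inner_F n k f (b x)) (b x))"
    using J orthonormal_finite_card(1)[OF ob] by (intro sum.mono_neutral_right) (auto simp: fun_eq_iff)
  finally show ?thesis .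
qed

lemma columns_in_orthonormal:
  assumes "orthonormal_basis n k I b" "x \<in> I" "y \<in> J" "v y \<in> Fun n k"
  shows "columns_in I b J v (x, y) = inner_F n k (v y) (b x)"
  using assms by (simp add: columns_in_def representation_eq_inner)


section \<open>Two-row diagrams\<close>

lemma two_row_altdef: "two_row p q = {(r, c). r = 0 \<and> c < p \<or> r = 1 \<and> c < q}"
  by (auto simp: two_row_def)

lemma finite_two_row [simp]: "finite (two_row p q)"
  by (simp add: two_row_def)

lemma card_two_row: "card (two_row p q) = p + q"
  unfolding two_row_def by (subst card_Un_disjoint) (auto simp: card_cartesian_product)

lemma two_row_subset_iff: "two_row p q \<subseteq> two_row p' q' \<longleftrightarrow> p \<le> p' \<and> q \<le> q'"
proof
  assume sub: "two_row p q \<subseteq> two_row p' q'"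
  have "c < p'" if "c < p" for c using that sub by (auto simp: two_row_altdef)
  moreover have "c < q'" if "c < q" for c using that sub by (auto simp: two_row_altdef)
  ultimately show "p \<le> p' \<and> q \<le> q'" by (metis not_le less_irrefl)
qed (auto simp: two_row_def)

lemma down_closed_eq_lessThan:
  assumes "finite (A :: nat set)" "\<And>a b. a \<in> A \<Longrightarrow> b \<le> a \<Longrightarrow> b \<in> A"
  shows "A = {..<card A}"
proof -
  define m where "m = (LEAST m. m \<notin> A)"
  have ex: "\<exists>m. m \<notin> A" using assms(1) ex_new_if_finite infinite_UNIV_nat by blast
  have "m \<notin> A" unfolding m_def using ex by (rule LeastI_ex)
  then have "A \<subseteq> {..<m}" using assms(2) by (meson lessThan_iff not_le subsetI)
  moreover have "{..<m} \<subseteq> A" unfolding m_def using not_less_Least by blast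
  ultimately have "A = {..<m}" by blast
  then show ?thesis by simp
qed

text \<open>Each row is a finite down-closed set of columns, hence an initial segment, and the
  second row sits below the first.\<close>

lemma young_subset_two_row:
  assumes \<nu>: "young_diagram \<nu>" and sub: "\<nu> \<subseteq> two_row p q"
  shows "\<exists>p' q'. q' \<le> p' \<and> \<nu> = two_row p' q'"
proof -
  let ?row = "\<lambda>r. {c. (r, c) \<in> \<nu>}"
  have fin: "finite \<nu>" and down: "\<And>r c r' c'. (r, c) \<in> \<nu> \<Longrightarrow> r' \<le> r \<Longrightarrow> c' \<le> c \<Longrightarrow> (r', c') \<in> \<nu>"
    using \<nu> unfolding young_diagram_def by blast+
  have fin_row: "finite (?row r)" for r
    by (rule finite_subset[of _ "snd ` \<nu>"]) (use fin in force)+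
  then have row: "?row r = {..<card (?row r)}" for r
    by (intro down_closed_eq_lessThan) (auto intro: down)
  have "\<nu> = two_row (card (?row 0)) (card (?row 1))"
  proof -
    have "(r, c) \<in> \<nu> \<longleftrightarrow> r = 0 \<and> c \<in> ?row 0 \<or> r = 1 \<and> c \<in> ?row 1" for r c
      using sub by (auto simp: two_row_altdef)
    then show ?thesis
      using row[of 0] row[of 1] unfolding two_row_altdef by blast
  qed
  moreover have "card (?row 1) \<le> card (?row 0)"
    using fin_row by (intro card_mono) (auto intro: down)
  ultimately show ?thesis by blast
qed

text \<open>The squares count the ordered pairs within a row; each of the \<open>q\<close> columns
  of height two gives two ordered pairs.\<close>

lemma pair_eigenvalue_two_row:
  assumes "q \<le> p"
  shows "pair_eigenvalue (two_row p q) = int p * int p + int q * int q - 2 * int q"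
proof -
  let ?\<nu> = "two_row p q"
  have "{(x, y). x \<in> ?\<nu> \<and> y \<in> ?\<nu> \<and> fst x = fst y}
      = ({0} \<times> {..<p}) \<times> ({0} \<times> {..<p}) \<union> ({1} \<times> {..<q}) \<times> ({1} \<times> {..<q})"
    by (auto simp: two_row_altdef)
  then have row: "card {(x, y). x \<in> ?\<nu> \<and> y \<in> ?\<nu> \<and> fst x = fst y} = p * p + q * q"
    by (simp only:) (subst card_Un_disjoint; auto simp: card_cartesian_product)
  have "{(x, y). x \<in> ?\<nu> \<and> y \<in> ?\<nu> \<and> x \<noteq> y \<and> snd x = snd y}
      = (\<lambda>c. ((0, c), (1, c))) ` {..<q} \<union> (\<lambda>c. ((1, c), (0, c))) ` {..<q}"
    using assms by (auto simp: two_row_altdef)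
  then have col: "card {(x, y). x \<in> ?\<nu> \<and> y \<in> ?\<nu> \<and> x \<noteq> y \<and> snd x = snd y} = q + q"
    by (simp only:) (subst card_Un_disjoint; auto simp: card_image inj_on_def)
  show ?thesis unfolding pair_eigenvalue_def row col by simp
qed

lemma pair_eigenvalue_two_row_inj:
  assumes "q \<le> p" "q' \<le> p'" "p + q = p' + q'"
    and "pair_eigenvalue (two_row p q) = pair_eigenvalue (two_row p' q')"
  shows "two_row p q = two_row p' q'"
proof -
  \<comment> \<open>The two eigenvalues differ by \<open>2 * d * (p - q + 1)\<close>, the effect of
    moving \<open>d\<close> boxes between the rows.\<close>
  have less: "pair_eigenvalue (two_row (p + d) q) \<noteq> pair_eigenvalue (two_row p (q + d))"
    if "0 < d" "q + d \<le> p" for p q d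
  proof -
    have "0 < 2 * int d * (int p - int q + 1)" using that by (intro mult_pos_pos) auto
    then show ?thesis using that by (simp add: pair_eigenvalue_two_row algebra_simps)
  qed
  consider "q = q'" | "q < q'" | "q' < q" by linarith
  then show ?thesis
  proof cases
    case 1
    then show ?thesis using assms by simp
  next
    case 2
    then have "p = p' + (q' - q)" "q' = q + (q' - q)" using assms(3) by auto
    then show ?thesis using less[of "q' - q" q p'] 2 assms by auto
  next
    case 3
    then have "p' = p + (q - q')" "q = q' + (q - q')" using assms(3) by auto
    then show ?thesis using less[of "q - q'" q' p] 3 assms by auto
  qed
qed


section \<open>Labels and blocks\<close>

definition two_row_chain :: "diagram list \<Rightarrow> bool" where
  "two_row_chain ls \<longleftrightarrow> (\<forall>j<length ls. \<exists>a. 2 * a \<le> Suc j \<and> ls ! j = two_row (Suc j - a) a)"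

lemma labels_nth_mono:
  assumes "(ls, c) \<in> labels n k i" "j \<le> j'" "j' < i"
  shows "ls ! j \<subseteq> ls ! j'"
  using assms(2,3)
proof (induction j' rule: dec_induct)
  case (step m)
  then have "adds_box (ls ! m) (ls ! Suc m)" using assms(1) by (simp add: labels_def)
  with step show ?case by (auto simp: adds_box_def)
qed simp

text \<open>A label prescribes the shape of its last diagram only; the earlier diagrams are
  contained in it and so have at most two rows as well.\<close>

lemma labels_two_row_chain:
  assumes x: "(ls, c) \<in> labels n k i"
  shows "two_row_chain ls"
  unfolding two_row_chain_def
proof (intro allI impI)
  fix j assume "j < length ls"
  then have j: "j < i" and \<nu>: "young_diagram (ls ! j)" "card (ls ! j) = Suc j"
    using x by (auto simp: labels_def)
  obtain a where "ls ! (i - 1) = two_row (i - a) a" using x j unfolding labels_def by auto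
  then have "ls ! j \<subseteq> two_row (i - a) a" using labels_nth_mono[OF x, of j "i - 1"] j by simp
  then obtain p q where "q \<le> p" "ls ! j = two_row p q" using young_subset_two_row[OF \<nu>(1)] by blast
  moreover from this \<nu>(2) have "p = Suc j - q" "2 * q \<le> Suc j" by (auto simp: card_two_row)
  ultimately show "\<exists>a. 2 * a \<le> Suc j \<and> ls ! j = two_row (Suc j - a) a" by blast
qed

text \<open>The joint eigenvalues of the class sums determine the chain, which is how different
  chains are told apart.\<close>

lemma two_row_chain_eqI:
  assumes "two_row_chain ls" "two_row_chain ls'" "length ls = length ls'"
    and "\<And>j. j < length ls \<Longrightarrow> pair_eigenvalue (ls ! j) = pair_eigenvalue (ls' ! j)"
  shows "ls = ls'"
proof (rule nth_equalityI)
  fix j assume j: "j < length ls"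
  obtain a a' where a: "2 * a \<le> Suc j" "ls ! j = two_row (Suc j - a) a"
    "2 * a' \<le> Suc j" "ls' ! j = two_row (Suc j - a') a'"
    using assms(1-3) j unfolding two_row_chain_def by metis
  then show "ls ! j = ls' ! j"
    using pair_eigenvalue_two_row_inj[of a "Suc j - a" a' "Suc j - a'"] assms(4)[OF j] by simp
qed (rule assms(3))

lemma two_row_chain_butlast: "two_row_chain ls \<Longrightarrow> two_row_chain (butlast ls)"
  by (auto simp: two_row_chain_def nth_butlast)

text \<open>The diagram with \<open>j\<close> boxes has index \<open>j - 1\<close>; for
  \<open>j = 0\<close> the class sum is empty and acts by 0.\<close>

definition chain_eigenvalue :: "diagram list \<Rightarrow> nat \<Rightarrow> int" where
  "chain_eigenvalue ls j = (if j = 0 then 0 else pair_eigenvalue (ls ! (j - 1)))"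

lemma class_sum_chain_space:
  assumes x: "(ls, c) \<in> labels n k i" and f: "f \<in> chain_space n k ls" and "j \<le> i"
  shows "class_sum j f = cscale (of_int (chain_eigenvalue ls j)) f"
proof (cases j)
  case 0
  then show ?thesis by (simp add: chain_eigenvalue_def class_sum_def fun_eq_iff)
next
  case (Suc m)
  then have "m < length ls" "young_diagram (ls ! m)" "card (ls ! m) = Suc m"
    using x assms(3) by (auto simp: labels_def)
  then show ?thesis
    using class_sum_isotypic[of "ls ! m" f n k] f Suc by (simp add: chain_space_def chain_eigenvalue_def)
qed

lemma suffix_space_support:
  assumes "f \<in> suffix_space n k c" "f w \<noteq> 0"
  shows "drop (n - length c) w = c"
proof -
  have "\<forall>w. f w \<noteq> 0 \<longrightarrow> drop (n - length c) w = c"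
    using assms(1) unfolding suffix_space_def
    by (induction rule: cfun.span_induct_alt) (auto simp: delta_def split: if_splits)
  with assms(2) show ?thesis by blast
qed

text \<open>Elements of \<open>B\<^sub>i\<close> with equal \<open>block\<close> and elements of \<open>B\<^sub>i\<^sub>-\<^sub>1\<close> with the corresponding
  \<open>block'\<close> span the same space, which \<open>(i i+1)\<close> preserves.\<close>

definition block :: "label \<Rightarrow> label" where
  "block x = (butlast (fst x), tl (snd x))"

definition block' :: "label \<Rightarrow> label" where
  "block' x = (fst x, tl (tl (snd x)))"

text \<open>Described by eigenvalues of class sums instead of isotypic components, since these
  suffice for orthogonality and are easily seen to be preserved by \<open>(i i+1)\<close>. The
  conditions on \<open>\<kappa>\<close> are part of the set so that membership of a function
  supplies them.\<close>

definition block_space :: "nat \<Rightarrow> nat \<Rightarrow> nat \<Rightarrow> label \<Rightarrow> (nat list \<Rightarrow> complex) set" where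
  "block_space n k i \<kappa> = {f \<in> Fun n k. length (fst \<kappa>) = i - 1 \<and> two_row_chain (fst \<kappa>) \<and>
     (\<forall>j<i. class_sum j f = cscale (of_int (chain_eigenvalue (fst \<kappa>) j)) f) \<and>
     (\<forall>w. f w \<noteq> 0 \<longrightarrow> drop (i + 1) w = snd \<kappa>)}"

text \<open>Different suffixes give disjoint supports; different chains give different eigenvalues
  of some self-adjoint class sum.\<close>

lemma block_space_orthogonal:
  assumes f: "f \<in> block_space n k i \<kappa>" and g: "g \<in> block_space n k i \<kappa>'" and "\<kappa> \<noteq> \<kappa>'" "i \<le> n"
  shows "inner_F n k f g = 0"
proof (cases "snd \<kappa> = snd \<kappa>'")
  case False
  then have "f w * cnj (g w) = 0" for w
    using f g by (auto simp: block_space_def)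
  then show ?thesis unfolding inner_F_def by (rule sum.neutral[OF ballI])
next
  case True
  then have "fst \<kappa> \<noteq> fst \<kappa>'" using assms(3) by (simp add: prod_eq_iff)
  then obtain j where "j < i - 1" "pair_eigenvalue (fst \<kappa> ! j) \<noteq> pair_eigenvalue (fst \<kappa>' ! j)"
    using two_row_chain_eqI[of "fst \<kappa>" "fst \<kappa>'"] f g by (auto simp: block_space_def)
  then have "chain_eigenvalue (fst \<kappa>) (Suc j) \<noteq> chain_eigenvalue (fst \<kappa>') (Suc j)" "Suc j < i"
    by (auto simp: chain_eigenvalue_def)
  then show ?thesis
    using f g assms(4) by (intro inner_F_class_sum_eigen[of "Suc j"]) (auto simp: block_space_def)
qed

text \<open>The transposition commutes with the class sums for \<open>j < i\<close> and leaves the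
  letters after position \<open>i + 1\<close> in place.\<close>

lemma act_mem_block_space:
  assumes f: "f \<in> block_space n k i \<kappa>" and i: "1 \<le> i" "i + 1 \<le> n"
  shows "act (transpose i (i + 1)) f \<in> block_space n k i \<kappa>"
proof -
  let ?s = "transpose i (i + 1)"
  have s: "?s permutes {1..i + 1}" "?s permutes {1..n}"
    using i by (auto intro!: permutes_swap_id)
  have "class_sum j (act ?s f) = cscale (of_int (chain_eigenvalue (fst \<kappa>) j)) (act ?s f)" if "j < i" for j
    using f that i by (subst class_sum_act_commute[of f n k]) (auto simp: block_space_def act_cscale simp del: One_nat_def)
  moreover have "drop (i + 1) w = snd \<kappa>" if "act ?s f w \<noteq> 0" for w
    using that f drop_act_word[OF s(1), of w] by (auto simp: block_space_def act_def)
  ultimately show ?thesis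
    using f act_mem_Fun[OF _ s(2)] by (auto simp: block_space_def)
qed

lemma intermediate_basis_mem:
  assumes "intermediate_basis n k i b" "(ls, c) \<in> labels n k i"
  shows "b (ls, c) \<in> chain_space n k ls" "b (ls, c) \<in> suffix_space n k c"
  using assms unfolding intermediate_basis_def by auto

lemma intermediate_basis_orthonormal:
  "intermediate_basis n k i b \<Longrightarrow> orthonormal_basis n k (labels n k i) b"
  by (simp add: intermediate_basis_def orthonormal_basis_def)

text \<open>Forgets the \<open>i\<close>-th diagram and the letter at position
  \<open>i + 1\<close>.\<close>

lemma intermediate_basis_block:
  assumes b: "intermediate_basis n k i b" and x: "x \<in> labels n k i" and i: "1 \<le> i" "i + 1 \<le> n"
  shows "b x \<in> block_space n k i (block x)"
proof -
  obtain ls c where xc: "x = (ls, c)" by (cases x)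
  note lab = x[unfolded xc]
  have len: "length ls = i" "length c = n - i" using lab by (auto simp: labels_def)
  have mem: "b x \<in> chain_space n k ls" "b x \<in> suffix_space n k c"
    using intermediate_basis_mem[OF b lab] by (simp_all add: xc)
  have "chain_eigenvalue (butlast ls) j = chain_eigenvalue ls j" if "j < i" for j
    using that len by (auto simp: chain_eigenvalue_def nth_butlast)
  moreover have "drop (i + 1) w = tl c" if "b x w \<noteq> 0" for w
  proof -
    have "drop i w = c" using suffix_space_support[OF mem(2) that] len i by simp
    then show ?thesis by (metis Suc_eq_plus1 drop_Suc tl_drop)
  qed
  ultimately show ?thesis
    using class_sum_chain_space[OF lab mem(1)] labels_two_row_chain[OF lab] len mem(1)
    by (simp add: block_space_def block_def xc two_row_chain_butlast chain_space_def)
qed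

text \<open>Keeps all \<open>i - 1\<close> diagrams and forgets the letters at positions
  \<open>i\<close> and \<open>i + 1\<close>.\<close>

lemma intermediate_basis_block':
  assumes b: "intermediate_basis n k (i - 1) b" and x: "x \<in> labels n k (i - 1)" and i: "1 \<le> i" "i + 1 \<le> n"
  shows "b x \<in> block_space n k i (block' x)"
proof -
  obtain ls c where xc: "x = (ls, c)" by (cases x)
  note lab = x[unfolded xc]
  have len: "length ls = i - 1" "length c = n - (i - 1)" using lab by (auto simp: labels_def)
  have mem: "b x \<in> chain_space n k ls" "b x \<in> suffix_space n k c"
    using intermediate_basis_mem[OF b lab] by (simp_all add: xc)
  have "drop (i + 1) w = tl (tl c)" if "b x w \<noteq> 0" for w
  proof -
    have "drop (i - 1) w = c" using suffix_space_support[OF mem(2) that] len i by simp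
    then have "tl (tl c) = drop (Suc (Suc (i - 1))) w" by (metis drop_Suc tl_drop)
    then show ?thesis using i by simp
  qed
  then show ?thesis
    using class_sum_chain_space[OF lab mem(1)] labels_two_row_chain[OF lab] len mem(1) i
    by (simp add: block_space_def block'_def xc chain_space_def)
qed

text \<open>The content of the \<open>i\<close>-th added box, solved from
  \<open>class_sum_Suc\<close>: consecutive eigenvalues differ by twice the content plus 1. For
  labels the division is exact by the parity lemma that follows.\<close>

definition box_content :: "nat \<Rightarrow> label \<Rightarrow> int" where
  "box_content i x = (chain_eigenvalue (fst x) i - chain_eigenvalue (fst x) (i - 1) - 1) div 2"

text \<open>Modulo 2 the eigenvalue of a two-row diagram is the sum of the squares of its row
  lengths, hence the number of boxes.\<close>

lemma chain_eigenvalue_parity: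
  assumes "two_row_chain ls" "j \<le> length ls"
  shows "even (chain_eigenvalue ls j + int j)"
proof (cases j)
  case (Suc m)
  then obtain a where a: "2 * a \<le> j" "ls ! m = two_row (j - a) a"
    using assms unfolding two_row_chain_def by (metis Suc_le_eq)
  then have "chain_eigenvalue ls j = int (j - a) * int (j - a) + int a * int a - 2 * int a"
    using Suc pair_eigenvalue_two_row[of a "j - a"] by (simp add: chain_eigenvalue_def)
  moreover have "int j = int (j - a) + int a" using a(1) by simp
  moreover have "even (E + J)" if "E = P * P + A * A - 2 * A" "J = P + A" for E J P A :: int
    unfolding that by auto
  ultimately show ?thesis by blast
qed (simp add: chain_eigenvalue_def)

text \<open>Both class sums whose difference determines the Jucys-Murphy element act on each basis
  element by scalars.\<close>

lemma jucys_murphy_intermediate_basis: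
  assumes b: "intermediate_basis n k i b" and x: "x \<in> labels n k i" and "1 \<le> i"
  shows "jucys_murphy i (b x) = cscale (of_int (box_content i x)) (b x)"
proof -
  obtain ls c where xc: "x = (ls, c)" by (cases x)
  note lab = x[unfolded xc]
  have len: "length ls = i" using lab by (auto simp: labels_def)
  have mem: "b x \<in> chain_space n k ls"
    using intermediate_basis_mem[OF b lab] by (simp add: xc)
  have "even (chain_eigenvalue ls i + int i)" "even (chain_eigenvalue ls (i - 1) + int (i - 1))"
    using labels_two_row_chain[OF lab] len by (simp_all add: chain_eigenvalue_parity del: even_add)
  then have "even (chain_eigenvalue ls i - chain_eigenvalue ls (i - 1) - 1)"
    using \<open>1 \<le> i\<close> by (auto simp: of_nat_diff)
  then have "chain_eigenvalue ls i = chain_eigenvalue ls (i - 1) + 2 * box_content i x + 1"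
    unfolding box_content_def xc by auto
  then have "jucys_murphy (Suc (i - 1)) (b x) = cscale (of_int (box_content i x)) (b x)"
    using class_sum_chain_space[OF lab mem] \<open>1 \<le> i\<close> by (intro jucys_murphy_eigen) auto
  then show ?thesis using \<open>1 \<le> i\<close> by simp
qed

section \<open>The size of the blocks\<close>

lemma labels_suffix_hd:
  assumes "(ls, c) \<in> labels n k i" "i < n"
  obtains d where "d \<in> {1, 2}" "c = d # tl c"
proof -
  have "c \<noteq> []" "set c \<subseteq> {1, 2}" using assms by (auto simp: labels_def)
  then show ?thesis using that[of "hd c"] by (cases c) auto
qed

text \<open>A box can be added to a two-row diagram only in its first or its second row if two rows
  are to remain. One \<open>b\<close> serves all labels with the same initial chain, which leaves
  two choices for the last diagram.\<close>

lemma block_last_cases: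
  assumes i: "1 \<le> i"
  shows "\<exists>b. \<forall>x\<in>labels n k i. butlast (fst x) = ls' \<longrightarrow> (\<exists>a\<in>{b, Suc b}. fst x = ls' @ [two_row (i - a) a])"
proof -
  have last: "\<exists>a. 2 * a \<le> i \<and> ls ! (i - 1) = two_row (i - a) a \<and> ls = butlast ls @ [two_row (i - a) a]"
    if lab: "(ls, c) \<in> labels n k i" for ls c
  proof -
    have len: "length ls = i" using lab by (auto simp: labels_def)
    then obtain a where a: "2 * a \<le> i" "ls ! (i - 1) = two_row (i - a) a"
      using labels_two_row_chain[OF lab] i unfolding two_row_chain_def by (metis Suc_diff_1 diff_less less_le_trans zero_less_one)
    have "last ls = ls ! (i - 1)" using len i by (simp add: last_conv_nth flip: length_greater_0_conv)
    then have "ls = butlast ls @ [two_row (i - a) a]"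
      using len i a(2) by (metis append_butlast_last_id list.size(3) not_one_le_zero)
    with a show ?thesis by blast
  qed
  show ?thesis
  proof (cases "i = 1")
    case True
    show ?thesis
    \<comment> \<open>Here the initial chain is empty, and \<open>2 * a \<le> 1\<close> forces
      \<open>a = 0\<close>.\<close>
    proof (intro exI[of _ 0] ballI impI)
      fix x assume "x \<in> labels n k i" "butlast (fst x) = ls'"
      then obtain a where "2 * a \<le> i" "fst x = ls' @ [two_row (i - a) a]"
        using last[of "fst x" "snd x"] by auto
      moreover from this have "a = 0" using True by simp
      ultimately show "\<exists>a\<in>{0, Suc 0}. fst x = ls' @ [two_row (i - a) a]" by blast
    qed
  next
    case False
    show ?thesis
    proof (cases "\<exists>x\<in>labels n k i. butlast (fst x) = ls'")
      case True
      then obtain ls0 c0 where lab0: "(ls0, c0) \<in> labels n k i" and ls0: "butlast ls0 = ls'" by auto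
      then have "length ls0 = i" by (auto simp: labels_def)
      \<comment> \<open>Index \<open>i - 2\<close> holds the diagram with \<open>i - 1\<close>
        boxes, the last one of the common initial chain.\<close>
      then obtain b where b: "2 * b \<le> i - 1" "ls0 ! (i - 2) = two_row (i - 1 - b) b"
      proof -
        have eq: "i - 2 < length ls0" "Suc (i - 2) = i - 1" using \<open>length ls0 = i\<close> i False by auto
        then obtain b where "2 * b \<le> Suc (i - 2) \<and> ls0 ! (i - 2) = two_row (Suc (i - 2) - b) b"
          using labels_two_row_chain[OF lab0] unfolding two_row_chain_def by blast
        then show ?thesis using that[of b] unfolding eq(2) by blast
      qed
      have ls': "ls' ! (i - 2) = two_row (i - 1 - b) b"
        unfolding ls0[symmetric] b(2)[symmetric] using \<open>length ls0 = i\<close> i False by (intro nth_butlast) simp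
      show ?thesis
      proof (intro exI[of _ b] ballI impI)
        fix x assume x: "x \<in> labels n k i" "butlast (fst x) = ls'"
        obtain ls c where xc: "x = (ls, c)" by (cases x)
        note lab = x(1)[unfolded xc]
        have len: "length ls = i" using lab by (auto simp: labels_def)
        obtain a where a: "2 * a \<le> i" "ls ! (i - 1) = two_row (i - a) a" "ls = butlast ls @ [two_row (i - a) a]"
          using last[OF lab] by blast
        have "ls ! (i - 2) \<subseteq> ls ! (i - 1)" using labels_nth_mono[OF lab, of "i - 2" "i - 1"] i by simp
        moreover have "ls ! (i - 2) = ls' ! (i - 2)" unfolding x(2)[symmetric] xc fst_conv using len i False by (intro nth_butlast[symmetric]) simp
        ultimately have "two_row (i - 1 - b) b \<subseteq> two_row (i - a) a" using ls' a(2) by simp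
        \<comment> \<open>Comparing second rows gives the lower bound on \<open>a\<close>; comparing
          first rows gives the upper bound.\<close>
        then have "b \<le> a" "a \<le> Suc b" using a(1) b(1) i by (auto simp: two_row_subset_iff)
        then have "a \<in> {b, Suc b}" by auto
        then show "\<exists>a\<in>{b, Suc b}. fst x = ls' @ [two_row (i - a) a]"
          using a(3) x(2) xc by auto
      qed
    qed auto
  qed
qed

text \<open>Two choices for the last diagram times two for the first letter of the suffix.\<close>

lemma card_block_le:
  assumes i: "1 \<le> i" "i + 1 \<le> n"
  shows "card {x \<in> labels n k i. block x = \<kappa>} \<le> 4" and "finite {x \<in> labels n k i. block x = \<kappa>}"
proof -
  obtain b where b: "\<forall>x\<in>labels n k i. butlast (fst x) = fst \<kappa> \<longrightarrow>
      (\<exists>a\<in>{b, Suc b}. fst x = fst \<kappa> @ [two_row (i - a) a])"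
    using block_last_cases[OF i(1)] by blast
  let ?f = "\<lambda>(a, d). (fst \<kappa> @ [two_row (i - a) a], d # snd \<kappa>)"
  have sub: "{x \<in> labels n k i. block x = \<kappa>} \<subseteq> ?f ` ({b, Suc b} \<times> {1, 2})"
  proof
    fix x assume x: "x \<in> {x \<in> labels n k i. block x = \<kappa>}"
    obtain ls c where xc: "x = (ls, c)" by (cases x)
    obtain a where a: "a \<in> {b, Suc b}" "ls = fst \<kappa> @ [two_row (i - a) a]"
      using b x xc by (fastforce simp: block_def)
    obtain d where "d \<in> {1, 2}" "c = d # tl c"
      using labels_suffix_hd[of ls c n k i] x xc i by auto
    moreover have "tl c = snd \<kappa>" using x xc by (auto simp: block_def)
    ultimately have "x = ?f (a, d)" "(a, d) \<in> {b, Suc b} \<times> {1, 2}" using a xc by auto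
    then show "x \<in> ?f ` ({b, Suc b} \<times> {1, 2})" by blast
  qed
  then show "finite {x \<in> labels n k i. block x = \<kappa>}" by (rule finite_subset) simp
  have "card {x \<in> labels n k i. block x = \<kappa>} \<le> card (?f ` ({b, Suc b} \<times> {1, 2}))"
    using sub by (rule card_mono[rotated]) simp
  also have "\<dots> \<le> card ({b, Suc b} \<times> {1, 2 :: nat})" by (rule card_image_le) simp
  finally show "card {x \<in> labels n k i. block x = \<kappa>} \<le> 4" by (simp add: card_cartesian_product)
qed

text \<open>Here the chain is fixed and the first two letters of the suffix are free.\<close>

lemma card_block'_le:
  assumes i: "1 \<le> i" "i + 1 \<le> n"
  shows "card {x \<in> labels n k (i - 1). block' x = \<kappa>} \<le> 4" and "finite {x \<in> labels n k (i - 1). block' x = \<kappa>}"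
proof -
  let ?f = "\<lambda>(d, e). (fst \<kappa>, d # e # snd \<kappa>)"
  have sub: "{x \<in> labels n k (i - 1). block' x = \<kappa>} \<subseteq> ?f ` ({1, 2} \<times> {1, 2})"
  proof
    fix x assume x: "x \<in> {x \<in> labels n k (i - 1). block' x = \<kappa>}"
    obtain ls c where xc: "x = (ls, c)" by (cases x)
    have c: "length c = n - (i - 1)" "set c \<subseteq> {1, 2}" using x xc by (auto simp: labels_def)
    then obtain d c' where "c = d # c'" using i by (cases c) auto
    moreover from this c obtain e c'' where "c' = e # c''" using i by (cases c') auto
    ultimately have "x = ?f (d, e)" "(d, e) \<in> {1, 2} \<times> {1, 2}" using x xc c(2) by (auto simp: block'_def)
    then show "x \<in> ?f ` ({1, 2} \<times> {1, 2})" by blast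
  qed
  then show "finite {x \<in> labels n k (i - 1). block' x = \<kappa>}" by (rule finite_subset) simp
  have "card {x \<in> labels n k (i - 1). block' x = \<kappa>} \<le> card (?f ` ({1, 2} \<times> {1, 2}))"
    using sub by (rule card_mono[rotated]) simp
  also have "\<dots> \<le> card ({1, 2 :: nat} \<times> {1, 2 :: nat})" by (rule card_image_le) simp
  finally show "card {x \<in> labels n k (i - 1). block' x = \<kappa>} \<le> 4" by (simp add: card_cartesian_product)
qed

section \<open>Compiling arithmetic formulas\<close>

text \<open>A shallow embedding: \<open>f\<close> maps the input to the value of the formula, and \<open>m\<close> bounds the number
  of its operations.\<close>

inductive formula :: "complex set \<Rightarrow> nat \<Rightarrow> (('p \<Rightarrow> complex) \<Rightarrow> complex) \<Rightarrow> bool" for Z where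
  const: "z \<in> Z \<Longrightarrow> formula Z m (\<lambda>inp. z)"
| input: "formula Z m (\<lambda>inp. inp p)"
| add: "formula Z m f \<Longrightarrow> formula Z m' g \<Longrightarrow> m + m' + 1 \<le> l \<Longrightarrow> formula Z l (\<lambda>inp. f inp + g inp)"
| mult: "formula Z m f \<Longrightarrow> formula Z m' g \<Longrightarrow> m + m' + 1 \<le> l \<Longrightarrow> formula Z l (\<lambda>inp. f inp * g inp)"
| conj: "formula Z m f \<Longrightarrow> m + 1 \<le> l \<Longrightarrow> formula Z l (\<lambda>inp. cnj (f inp))"

lemma formula_mono: "formula Z m f \<Longrightarrow> m \<le> l \<Longrightarrow> formula Z l f"
  by (cases rule: formula.cases) (auto intro: formula.intros order_trans)

text \<open>The sum starts from the constant 0, and every term pays for one addition.\<close>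

lemma formula_sum:
  assumes "finite A" "0 \<in> Z" "\<And>x. x \<in> A \<Longrightarrow> formula Z m (f x)" "card A \<le> c"
  shows "formula Z (c * (m + 1)) (\<lambda>inp. \<Sum>x\<in>A. f x inp)"
proof -
  have "formula Z (card A * (m + 1)) (\<lambda>inp. \<Sum>x\<in>A. f x inp)"
    using assms(1,3)
  proof (induction A)
    case empty
    show ?case using assms(2) by (simp add: formula.const)
  next
    case (insert a A)
    then show ?case
      by (auto intro!: formula.add[of Z m "f a" "card A * (m + 1)"])
  qed
  then show ?thesis by (rule formula_mono) (use assms(4) mult_le_mono1 in blast)
qed

section \<open>Running concatenated programs\<close>

lemma run_append: "run inp (P @ Q) = foldl (\<lambda>vs ins. vs @ [instr_value inp vs ins]) (run inp P) Q"
  by (simp add: run_def)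

lemma run_snoc: "run inp (P @ [ins]) = run inp P @ [instr_value inp (run inp P) ins]"
  by (simp add: run_append)

lemma length_run [simp]: "length (run inp P) = length P"
  by (induction P rule: rev_induct) (simp_all add: run_snoc, simp add: run_def)

lemma fetch_run_append: "a < length P \<Longrightarrow> fetch (run inp (P @ Q)) a = fetch (run inp P) a"
proof (induction Q rule: rev_induct)
  case (snoc ins Q)
  then show ?case
    by (simp only: append_assoc[symmetric] run_snoc) (simp add: fetch_def nth_append)
qed simp

lemma fetch_run_snoc: "fetch (run inp (P @ [ins])) (length P) = instr_value inp (run inp P) ins"
  by (simp add: run_snoc fetch_def nth_append)

lemma op_count_append: "op_count (P @ Q) = op_count P + op_count Q"
  by (simp add: op_count_def)

lemma constants_append: "constants (P @ Q) = constants P \<union> constants Q"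
  by (auto simp: constants_def)

text \<open>Addresses are absolute, so the code is built behind an arbitrary prefix
  \<open>P\<close>; appending more code later does not change the values already computed. The code
  and its result address are chosen before the input.\<close>

lemma compile_formula:
  assumes "formula Z m f"
  shows "\<exists>Q a. constants Q \<subseteq> Z \<and> op_count Q \<le> m \<and> a < length (P @ Q) \<and>
    (\<forall>inp. fetch (run inp (P @ Q)) a = f inp)"
  using assms
proof (induction arbitrary: P)
  case (const z m)
  then show ?case
    by (intro exI[of _ "[Const z]"] exI[of _ "length P"])
      (auto simp: fetch_run_snoc constants_def op_count_def)
next
  case (input m p)
  then show ?case
    by (intro exI[of _ "[Input p]"] exI[of _ "length P"])
      (auto simp: fetch_run_snoc constants_def op_count_def)
next
  case (add m f m' g l)
  obtain Q a where Q: "constants Q \<subseteq> Z" "op_count Q \<le> m" "a < length (P @ Q)"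
    "\<forall>inp. fetch (run inp (P @ Q)) a = f inp" using add.IH(1)[of P] by blast
  obtain R b where R: "constants R \<subseteq> Z" "op_count R \<le> m'" "b < length ((P @ Q) @ R)"
    "\<forall>inp. fetch (run inp ((P @ Q) @ R)) b = g inp" using add.IH(2)[of "P @ Q"] by blast
  let ?P = "(P @ Q) @ R"
  have "\<forall>inp. fetch (run inp (?P @ [Add a b])) (length ?P) = f inp + g inp"
    using Q(4) R(4) fetch_run_append[OF Q(3)] by (simp only: fetch_run_snoc instr_value.simps simp_thms)
  moreover have "constants (Q @ R @ [Add a b]) \<subseteq> Z" "op_count (Q @ R @ [Add a b]) \<le> l"
    using Q R add.hyps by (auto simp: constants_append op_count_append constants_def op_count_def)
  ultimately show ?case
    by (intro exI[of _ "Q @ R @ [Add a b]"] exI[of _ "length ?P"]) auto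
next
  case (mult m f m' g l)
  obtain Q a where Q: "constants Q \<subseteq> Z" "op_count Q \<le> m" "a < length (P @ Q)"
    "\<forall>inp. fetch (run inp (P @ Q)) a = f inp" using mult.IH(1)[of P] by blast
  obtain R b where R: "constants R \<subseteq> Z" "op_count R \<le> m'" "b < length ((P @ Q) @ R)"
    "\<forall>inp. fetch (run inp ((P @ Q) @ R)) b = g inp" using mult.IH(2)[of "P @ Q"] by blast
  let ?P = "(P @ Q) @ R"
  have "\<forall>inp. fetch (run inp (?P @ [Mult a b])) (length ?P) = f inp * g inp"
    using Q(4) R(4) fetch_run_append[OF Q(3)] by (simp only: fetch_run_snoc instr_value.simps simp_thms)
  moreover have "constants (Q @ R @ [Mult a b]) \<subseteq> Z" "op_count (Q @ R @ [Mult a b]) \<le> l"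
    using Q R mult.hyps by (auto simp: constants_append op_count_append constants_def op_count_def)
  ultimately show ?case
    by (intro exI[of _ "Q @ R @ [Mult a b]"] exI[of _ "length ?P"]) auto
next
  case (conj m f l)
  obtain Q a where Q: "constants Q \<subseteq> Z" "op_count Q \<le> m" "a < length (P @ Q)"
    "\<forall>inp. fetch (run inp (P @ Q)) a = f inp" using conj.IH[of P] by blast
  let ?P = "P @ Q"
  have "\<forall>inp. fetch (run inp (?P @ [Conj a])) (length ?P) = cnj (f inp)"
    using Q(4) by (simp only: fetch_run_snoc instr_value.simps simp_thms)
  moreover have "constants (Q @ [Conj a]) \<subseteq> Z" "op_count (Q @ [Conj a]) \<le> l"
    using Q conj.hyps by (auto simp: constants_append op_count_append constants_def op_count_def)
  ultimately show ?case
    by (intro exI[of _ "Q @ [Conj a]"] exI[of _ "length ?P"]) auto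
qed

lemma compile_formulas:
  assumes "finite D" "\<And>d. d \<in> D \<Longrightarrow> formula Z m (F d)"
  shows "\<exists>P out. constants P \<subseteq> Z \<and> op_count P \<le> card D * m \<and>
    (\<forall>inp. \<forall>d\<in>D. out d < length P \<and> fetch (run inp P) (out d) = F d inp)"
  using assms
proof (induction D)
  case empty
  show ?case by (intro exI[of _ "[]"]) (simp add: constants_def op_count_def)
next
  case (insert d D)
  then obtain P out where P: "constants P \<subseteq> Z" "op_count P \<le> card D * m"
    "\<forall>inp. \<forall>d\<in>D. out d < length P \<and> fetch (run inp P) (out d) = F d inp" by auto
  obtain Q a where Q: "constants Q \<subseteq> Z" "op_count Q \<le> m" "a < length (P @ Q)"
    "\<forall>inp. fetch (run inp (P @ Q)) a = F d inp" using compile_formula[OF insert.prems[of d], of P] by auto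
  have "constants (P @ Q) \<subseteq> Z" "op_count (P @ Q) \<le> card (insert d D) * m"
    using P Q insert.hyps by (auto simp: constants_append op_count_append)
  moreover have "(out(d := a)) e < length (P @ Q) \<and> fetch (run inp (P @ Q)) ((out(d := a)) e) = F e inp"
    if "e \<in> insert d D" for inp e
  proof (cases "e = d")
    case False
    then have "e \<in> D" using that by simp
    then have "out e < length P" "fetch (run inp P) (out e) = F e inp" using P(3) by blast+
    then show ?thesis using False by (simp add: fetch_run_append)
  qed (use Q in simp)
  ultimately show ?case by blast
qed

lemma compile_sparse_matrix:
  assumes "finite D" "\<And>d. d \<in> D \<Longrightarrow> formula Z m (F d)"
  shows "\<exists>P out. constants P \<subseteq> Z \<and> op_count P \<le> card D * m \<and>
    (\<forall>inp d. fetch (run inp P) (out d) = (if d \<in> D then F d inp else 0))"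
proof -
  obtain P out where P: "constants P \<subseteq> Z" "op_count P \<le> card D * m"
    "\<forall>inp. \<forall>d\<in>D. out d < length P \<and> fetch (run inp P) (out d) = F d inp"
    using compile_formulas[OF assms(1), of Z m F] assms(2) by blast
  \<comment> \<open>An address beyond the program reads as 0 by the convention in
    \<open>fetch\<close>, so the zero entries cost nothing.\<close>
  define out' where "out' d = (if d \<in> D then out d else length P)" for d
  have "fetch (run inp P) (out' d) = (if d \<in> D then F d inp else 0)" for inp d
    unfolding out'_def using P(3) by (cases "d \<in> D") (simp_all, simp add: fetch_def)
  with P(1,2) show ?thesis by (intro exI[of _ P] exI[of _ out']) simp
qed

section \<open>The matrix of the Jucys-Murphy operator\<close>

text \<open>The matrix entry of \<open>(i i+1)\<close> in \<open>B\<^sub>i\<close>, expressed through the matrix \<open>S\<close> of \<open>(i i+1)\<close> in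
  \<open>B\<^sub>i\<^sub>-\<^sub>1\<close> and the change of basis matrix \<open>A\<close>.\<close>

definition swap_entry :: "nat \<Rightarrow> nat \<Rightarrow> nat \<Rightarrow> lmatrix \<Rightarrow> label \<Rightarrow> label \<Rightarrow> lmatrix \<Rightarrow> complex" where
  "swap_entry n k i S x y A =
     (\<Sum>u\<in>{u \<in> labels n k (i - 1). block' u = block x}. \<Sum>v\<in>{v \<in> labels n k (i - 1). block' v = block x}.
       cnj (A (u, x)) * S (u, v) * A (v, y))"

text \<open>Comes from \<open>J\<^sub>i\<^sub>+\<^sub>1 = s J\<^sub>i s + s\<close> with \<open>s = (i i+1)\<close>, since \<open>J\<^sub>i\<close> is diagonal in \<open>B\<^sub>i\<close>.\<close>

definition jucys_murphy_entry :: "nat \<Rightarrow> nat \<Rightarrow> nat \<Rightarrow> lmatrix \<Rightarrow> label \<times> label \<Rightarrow> lmatrix \<Rightarrow> complex" where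
  "jucys_murphy_entry n k i S xy A =
     (\<Sum>z\<in>{z \<in> labels n k i. block z = block (fst xy)}.
       swap_entry n k i S (fst xy) z A * of_int (box_content i z) * swap_entry n k i S z (snd xy) A)
     + swap_entry n k i S (fst xy) (snd xy) A"

lemma formula_swap_entry:
  assumes "1 \<le> i" "i + 1 \<le> n"
  shows "formula (\<int> \<union> range S) 68 (swap_entry n k i S x y)"
proof -
  let ?Z = "\<int> \<union> range S" and ?U = "{u \<in> labels n k (i - 1). block' u = block x}"
  note U = card_block'_le[OF assms, where k = k and \<kappa> = "block x"]
  \<comment> \<open>Three operations per term: one conjugation and two multiplications. With at most
    four terms in each sum, the total is \<open>4 * (4 * (3 + 1) + 1) = 68\<close>.\<close>
  have "formula ?Z 3 (\<lambda>A. cnj (A (u, x)) * S (u, v) * A (v, y))" for u v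
    by (intro formula.mult[where m = 2 and m' = 0] formula.mult[where m = 1 and m' = 0]
        formula.conj[where m = 0] formula.const formula.input) auto
  then have "formula ?Z (4 * (3 + 1)) (\<lambda>A. \<Sum>v\<in>?U. cnj (A (u, x)) * S (u, v) * A (v, y))" for u
    by (rule formula_sum[OF U(2) _ _ U(1), rotated]) auto
  then have "formula ?Z (4 * (4 * (3 + 1) + 1)) (\<lambda>A. \<Sum>u\<in>?U. \<Sum>v\<in>?U. cnj (A (u, x)) * S (u, v) * A (v, y))"
    by (rule formula_sum[OF U(2) _ _ U(1), rotated]) auto
  then show ?thesis by (simp add: swap_entry_def[abs_def])
qed

lemma formula_jucys_murphy_entry:
  assumes "1 \<le> i" "i + 1 \<le> n"
  shows "formula (\<int> \<union> range S) 625 (jucys_murphy_entry n k i S xy)"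
proof -
  let ?Z = "\<int> \<union> range S"
  \<comment> \<open>Two swap entries at 68 each and two multiplications. Four such terms with their
    additions cost \<open>4 * 139 = 556\<close>; adding the last swap entry gives
    \<open>556 + 68 + 1 = 625\<close>.\<close>
  have "formula ?Z 138 (\<lambda>A. swap_entry n k i S (fst xy) z A * of_int (box_content i z)
      * swap_entry n k i S z (snd xy) A)" for z
    by (intro formula.mult[where m = 69 and m' = 68] formula.mult[where m = 68 and m' = 0]
        formula_swap_entry[OF assms] formula.const) auto
  then have "formula ?Z (4 * (138 + 1)) (\<lambda>A. \<Sum>z\<in>{z \<in> labels n k i. block z = block (fst xy)}.
      swap_entry n k i S (fst xy) z A * of_int (box_content i z) * swap_entry n k i S z (snd xy) A)"
    by (rule formula_sum[OF card_block_le(2)[OF assms] _ _ card_block_le(1)[OF assms], rotated]) auto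
  then show ?thesis
    unfolding jucys_murphy_entry_def[abs_def]
    by (rule formula.add[OF _ formula_swap_entry[OF assms]]) simp
qed

context
  fixes n k i :: nat and B' B :: "label \<Rightarrow> nat list \<Rightarrow> complex"
  assumes i: "1 \<le> i" "i + 1 \<le> n"
    and B': "intermediate_basis n k (i - 1) B'" and B: "intermediate_basis n k i B"
begin

private abbreviation (input) "L \<equiv> labels n k i"
private abbreviation (input) "L' \<equiv> labels n k (i - 1)"
private abbreviation (input) "s \<equiv> act (transpose i (i + 1))"
private abbreviation (input) "A \<equiv> change_matrix n k i B (i - 1) B'"
private abbreviation (input) "S \<equiv> operator_matrix n k (i - 1) B' s"

lemma swap_permutes: "transpose i (i + 1) permutes {1..n}"
  using i by (auto intro!: permutes_swap_id)

lemma basis_mem_Fun: "x \<in> L \<Longrightarrow> B x \<in> Fun n k" "u \<in> L' \<Longrightarrow> B' u \<in> Fun n k"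
  using intermediate_basis_block[OF B _ i] intermediate_basis_block'[OF B' _ i]
  by (auto simp: block_space_def)

text \<open>Since the transposition preserves blocks, entries between different blocks vanish.
  Within a block this is the product of the conjugate transpose of \<open>A\<close>,
  \<open>S\<close> and \<open>A\<close>, with both basis elements expanded in the matching block of
  \<open>B'\<close>.\<close>

lemma inner_swap_basis:
  assumes x: "x \<in> L" and y: "y \<in> L"
  shows "inner_F n k (s (B y)) (B x) = (if block x = block y then swap_entry n k i S x y A else 0)"
proof (cases "block x = block y")
  case False
  then show ?thesis
    using block_space_orthogonal[OF act_mem_block_space[OF intermediate_basis_block[OF B y i] i]
        intermediate_basis_block[OF B x i]] i by auto
next
  case True
  let ?U = "{u \<in> L'. block' u = block x}"
  have A_eq: "A (u, z) = inner_F n k (B z) (B' u)" if "u \<in> L'" "z \<in> L" for u z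
    unfolding change_matrix_def using that
    by (intro columns_in_orthonormal[OF intermediate_basis_orthonormal[OF B']] basis_mem_Fun)
  have S_eq: "S (u, v) = inner_F n k (s (B' v)) (B' u)" if "u \<in> L'" "v \<in> L'" for u v
    unfolding operator_matrix_def using that
    by (intro columns_in_orthonormal[OF intermediate_basis_orthonormal[OF B']]
        act_mem_Fun[OF _ swap_permutes] basis_mem_Fun)
  have expand: "B z = (\<Sum>u\<in>?U. cscale (A (u, z)) (B' u))" if z: "z \<in> L" and "block z = block x" for z
  proof -
    have "B z = (\<Sum>u\<in>?U. cscale (inner_F n k (B z) (B' u)) (B' u))"
    proof (rule orthonormal_expansion[OF intermediate_basis_orthonormal[OF B'] basis_mem_Fun(1)[OF z]])
      fix u assume "u \<in> L' - ?U"
      then show "inner_F n k (B z) (B' u) = 0"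
        using block_space_orthogonal[OF intermediate_basis_block[OF B z i] intermediate_basis_block'[OF B' _ i, of u]]
          that i by auto
    qed auto
    also have "\<dots> = (\<Sum>u\<in>?U. cscale (A (u, z)) (B' u))"
      by (rule sum.cong) (simp_all add: A_eq z del: One_nat_def)
    finally show ?thesis .
  qed
  have "inner_F n k (s (B y)) (B x)
      = inner_F n k (s (\<Sum>v\<in>?U. cscale (A (v, y)) (B' v))) (\<Sum>u\<in>?U. cscale (A (u, x)) (B' u))"
    using expand[OF x] expand[OF y] True by simp
  also have "\<dots> = (\<Sum>u\<in>?U. \<Sum>v\<in>?U. cnj (A (u, x)) * (A (v, y) * inner_F n k (s (B' v)) (B' u)))"
    unfolding act_sum act_cscale inner_F_sum_right inner_F_sum_left inner_F_cscale_right inner_F_cscale_left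
    by (simp add: sum_distrib_left)
  also have "\<dots> = swap_entry n k i S x y A"
    unfolding swap_entry_def by (intro sum.cong refl) (simp add: S_eq del: One_nat_def)
  finally show ?thesis using True by simp
qed

text \<open>In \<open>s J_i s + s\<close>, the first \<open>s\<close> is expanded within the block
  of \<open>y\<close>, \<open>J_i\<close> multiplies by contents, and the second \<open>s\<close>
  again stays in the block; between different blocks every term is 0.\<close>

lemma operator_matrix_jucys_murphy:
  assumes x: "x \<in> L" and y: "y \<in> L"
  shows "operator_matrix n k i B (jucys_murphy (i + 1)) (x, y)
    = (if block x = block y then jucys_murphy_entry n k i S (x, y) A else 0)"
proof -
  let ?V = "{z \<in> L. block z = block y}"
  note ob = intermediate_basis_orthonormal[OF B]
  have sy: "s (B y) \<in> Fun n k" by (rule act_mem_Fun[OF basis_mem_Fun(1)[OF y] swap_permutes])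
  have "operator_matrix n k i B (jucys_murphy (i + 1)) (x, y) = inner_F n k (jucys_murphy (i + 1) (B y)) (B x)"
    unfolding operator_matrix_def using x y i
    by (intro columns_in_orthonormal[OF ob] jucys_murphy_mem_Fun basis_mem_Fun) auto
  also have "\<dots> = inner_F n k (s (jucys_murphy i (s (B y)))) (B x) + inner_F n k (s (B y)) (B x)"
    unfolding jucys_murphy_Suc[OF basis_mem_Fun(1)[OF y] i] inner_F_add_left ..
  also have "inner_F n k (s (jucys_murphy i (s (B y)))) (B x)
      = (\<Sum>z\<in>?V. swap_entry n k i S z y A * (of_int (box_content i z) * inner_F n k (s (B z)) (B x)))"
  proof -
    have "s (B y) = (\<Sum>z\<in>?V. cscale (inner_F n k (s (B y)) (B z)) (B z))"
      by (rule orthonormal_expansion[OF ob sy]) (auto simp: inner_swap_basis y simp del: One_nat_def)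
    also have "\<dots> = (\<Sum>z\<in>?V. cscale (swap_entry n k i S z y A) (B z))"
      by (rule sum.cong) (simp_all add: inner_swap_basis y del: One_nat_def)
    finally have "jucys_murphy i (s (B y)) = (\<Sum>z\<in>?V. cscale (swap_entry n k i S z y A) (jucys_murphy i (B z)))"
      by (simp only: jucys_murphy_sum jucys_murphy_cscale)
    also have "\<dots> = (\<Sum>z\<in>?V. cscale (swap_entry n k i S z y A) (cscale (of_int (box_content i z)) (B z)))"
      using jucys_murphy_intermediate_basis[OF B _ i(1)] by (intro sum.cong) simp_all
    finally show ?thesis
      by (simp only: act_sum act_cscale inner_F_sum_left inner_F_cscale_left)
  qed
  finally have *: "operator_matrix n k i B (jucys_murphy (i + 1)) (x, y)
      = (\<Sum>z\<in>?V. swap_entry n k i S z y A * (of_int (box_content i z) * inner_F n k (s (B z)) (B x)))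
        + inner_F n k (s (B y)) (B x)" .
  show ?thesis
  proof (cases "block x = block y")
    case True
    then show ?thesis
      unfolding * jucys_murphy_entry_def fst_conv snd_conv if_P[OF True]
      by (intro arg_cong2[where f = "(+)"] sum.cong) (auto simp: inner_swap_basis x y True simp del: One_nat_def)
  next
    case False
    then show ?thesis
      unfolding * by (auto simp: inner_swap_basis x y simp del: One_nat_def intro!: sum.neutral)
  qed
qed

end

theorem proposition2:
  "\<exists>C::real. \<forall>n k i :: nat. k \<le> n \<longrightarrow> 1 \<le> i \<longrightarrow> i \<le> n - 1 \<longrightarrow>
     (\<forall>S :: lmatrix. \<exists>(P :: (label \<times> label) instr list) (out :: label \<times> label \<Rightarrow> nat).
        constants P \<subseteq> \<int> \<union> range S \<and>
        real (op_count P) \<le> C * real (n choose k) \<and>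
        (\<forall>B' B. intermediate_basis n k (i - 1) B' \<longrightarrow>
                intermediate_basis n k i B \<longrightarrow>
                operator_matrix n k (i - 1) B' (act (transpose i (i + 1))) = S \<longrightarrow>
                computes_matrix P out (change_matrix n k i B (i - 1) B') (labels n k i)
                  (operator_matrix n k i B (jucys_murphy (i + 1)))))"
proof (rule exI[of _ 2500], intro allI impI)
  fix n k i :: nat and S :: lmatrix
  assume "1 \<le> i" "i \<le> n - 1"
  then have i: "1 \<le> i" "i + 1 \<le> n" by auto
  let ?L = "labels n k i" and ?s = "act (transpose i (i + 1))" and ?J = "jucys_murphy (i + 1)"
  let ?good = "\<lambda>P out. \<forall>B' B. intermediate_basis n k (i - 1) B' \<longrightarrow> intermediate_basis n k i B \<longrightarrow>
    operator_matrix n k (i - 1) B' ?s = S \<longrightarrow>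
    computes_matrix P out (change_matrix n k i B (i - 1) B') ?L (operator_matrix n k i B ?J)"
  show "\<exists>(P :: (label \<times> label) instr list) (out :: label \<times> label \<Rightarrow> nat).
    constants P \<subseteq> \<int> \<union> range S \<and> real (op_count P) \<le> 2500 * real (n choose k) \<and> ?good P out"
  \<comment> \<open>The program has to be fixed before the bases. If there is no basis, the empty
    program will do; otherwise one basis \<open>B0\<close> serves only to bound the number of
    labels.\<close>
  proof (cases "\<exists>B. intermediate_basis n k i B")
    case False
    then show ?thesis by (intro exI[of _ "[]"]) (simp add: constants_def op_count_def)
  next
    case True
    then obtain B0 where "intermediate_basis n k i B0" ..
    note L = orthonormal_finite_card[OF intermediate_basis_orthonormal[OF this]]
    \<comment> \<open>The positions within blocks, at most four in each row. At 625 operations each,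
      this accounts for \<open>4 * 625 = 2500\<close>.\<close>
    define D where "D = Sigma ?L (\<lambda>x. {y \<in> ?L. block y = block x})"
    have "finite D" using L(1) by (auto simp: D_def)
    then obtain P out where P: "constants P \<subseteq> \<int> \<union> range S" "op_count P \<le> card D * 625"
      "\<forall>inp d. fetch (run inp P) (out d) = (if d \<in> D then jucys_murphy_entry n k i S d inp else 0)"
      using compile_sparse_matrix[of D "\<int> \<union> range S" 625 "jucys_murphy_entry n k i S"]
        formula_jucys_murphy_entry[OF i] by blast
    have "card D = (\<Sum>x\<in>?L. card {y \<in> ?L. block y = block x})"
      unfolding D_def using L(1) by (subst card_SigmaI) auto
    also have "\<dots> \<le> card ?L * 4"
      using sum_bounded_above[of ?L "\<lambda>x. card {y \<in> ?L. block y = block x}" 4] card_block_le(1)[OF i] by simp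
    also have "\<dots> \<le> (n choose k) * 4" using L(2) by simp
    finally have "op_count P \<le> 2500 * (n choose k)" using P(2) by simp
    then have "real (op_count P) \<le> 2500 * real (n choose k)" by linarith
    moreover have "?good P out"
      unfolding computes_matrix_def
      using P(3) operator_matrix_jucys_murphy[OF i] by (auto simp: D_def simp del: One_nat_def)
    ultimately show ?thesis using P(1) by blast
  qed
qed

end
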